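(* Consider the system with unknown constant disturbance $\Delta\in\mathbb R^3$, $\|\Delta\|\le\delta$, $$\dot R=R\hat\Omega,\qquad\mathbb I\dot\Omega=(\mathbb I\Omega)\times\Omega+\tau+\Delta.$$ Choose any positive numbers $k_R,k_\Omega,k_\Delta,a,\mu,\epsilon,\theta_{b_0},\gamma$ such that $0<a<1$, $0<\epsilon<1$, $$0<\mu<\frac{4(1-a)k_Rk_\Omega}{4(1-a)k_R+k_\Omega^2},\qquad B:=2a\frac{\sqrt{k_R}-\mu}{\sqrt{k_R}+\mu}k_R-\frac1{2k_\Delta}\delta^2>0,$$ $$\theta_{b_0}\in(0,\theta_0),\qquad1-\cos(\theta_0-\theta_{b_0})\le\left(2a\frac{\sqrt{k_R}-\mu}{\sqrt{k_R}+\mu}-\frac1{2k_\Delta k_R}\delta^2\right)\epsilon,\qquad\gamma<\frac2{\theta_{b_0}}\sqrt{2(1-\epsilon)B},$$ where the conditions involving $\theta_0$ (the angle determined by the initial attitude) concern the initial states for which the second case of the control below is used. Let the control input and adaptive law be: when $V_0(R(0),\Omega(0),0)\le B$, $$\tau=-(\mathbb I\Omega)\times\Omega+\mathbb I(-k_Re_R-k_\Omega e_\Omega+\Omega\times\Omega_d+\dot\Omega_d)-\bar\Delta,\qquad\dot{\bar\Delta}=k_\Delta\mathbb I^{-1}(e_\Omega+\mu e_R);$$ and when $V_0(R(0),\Omega(0),0)>B$, $$\tau=-(\mathbb I\Omega)\times\Omega+\mathbb I(-k_R\tilde e_R-k_\Omega\tilde e_\Omega+\Omega\times\tilde\Omega_d+\dot{\tilde\Omega}_d)-\bar\Delta,\qquad\dot{\bar\Delta}=k_\Delta\mathbb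 I^{-1}(\tilde e_\Omega+\mu\tilde e_R);$$ with $\bar\Delta(0)=0$ in both cases. Then the zero equilibrium of the errors $(E_R,e_\Omega,e_\Delta)=(0,0,0)$ is asymptotically stable.
   Context: $\|A\|^2=\operatorname{tr}(A^TA)$ for a matrix or vector $A$. The hat map is defined by $\hat v w=v\times w$ for $v,w\in\mathbb R^3$; $\vee$ is its inverse on skew-symmetric matrices. $e_3=(0,0,1)$, $Z_\theta=\exp(\theta\hat e_3)$. $\mathbb I\in\mathbb R^{3\times3}$ is a symmetric positive-definite (inertia) matrix, $R\in \mathrm{SO}(3)$ the attitude, $\Omega\in\mathbb R^3$ the angular velocity, $\bar\Delta\in\mathbb R^3$ the disturbance estimate, $\delta>0$ a known bound on the disturbance. $(R_d(t),\Omega_d(t))\in \mathrm{SO}(3)\times\mathbb R^3$, $t\ge0$, is a given smooth reference trajectory with $\dot R_d=R_d\hat\Omega_d$, such that $\Omega_d(t)$ and $\dot\Omega_d(t)$ are bounded. Errors: $E_R=R-R_d$, $e_\Omega=\Omega-\Omega_d$, $e_\Delta=\Delta-\bar\Delta$, $e_R=\frac12(R_d^TR-R^TR_d)^\vee$, and $V_0(R,\Omega,t)=\frac{k_R}4\|E_R\|^2+\frac12\|e_\Omega\|^2$. Shifted reference: given $R(0)$, let $\theta_0\in[0,\pi]$ be the unique angle for which there is $U_0\in \mathrm{SO}(3)$ with $R(0)=U_0Z_{\theta_0}U_0^TR_d(0)$, and fix such a $U_0$. With $\theta_{b_0}\in(0,\theta_0)$ set $$\theta_b(t)=\theta_{b_0}e^{-\frac\gamma2t},\quad\tilde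 R_d(t)=U_0Z_{\theta_b(t)}U_0^TR_d(t),\quad\tilde\Omega_d(t)=\Omega_d(t)+\dot\theta_b(t)\tilde R_d(t)^TU_0e_3,$$ so that $\dot{\tilde R}_d=\tilde R_d\hat{\tilde\Omega}_d$. The shifted errors are $\tilde e_R=\frac12(\tilde R_d^TR-R^T\tilde R_d)^\vee$ and $\tilde e_\Omega=\Omega-\tilde\Omega_d$. Asymptotic stability of the zero equilibrium is meant for the closed-loop system in the state $(R,\Omega,\bar\Delta)$ (so initial estimates near $\Delta$ are considered there); $\bar\Delta(0)=0$ is the initialization used by the controller. *)

theory Defs
  imports "HOL-Analysis.Analysis"
begin

type_synonym vec3 = "real ^ 3"
type_synonym mat3 = "real ^ 3 ^ 3"

text \<open>The library norm on \<^typ>\<open>real^'n^'m\<close> is the Frobenius norm.\<close>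

lemma norm_matrix_trace:
  fixes A :: "real ^ 'n ^ 'm"
  shows "(norm A)\<^sup>2 = trace (transpose A ** A)"
proof -
  have "(norm A)\<^sup>2 = (\<Sum>i\<in>UNIV. \<Sum>j\<in>UNIV. A $ i $ j * A $ i $ j)"
    by (simp add: power2_norm_eq_inner inner_vec_def)
  also have "\<dots> = (\<Sum>j\<in>UNIV. \<Sum>i\<in>UNIV. A $ i $ j * A $ i $ j)"
    by (rule sum.swap)
  finally show ?thesis
    by (simp add: trace_def matrix_matrix_mult_def transpose_def)
qed

definition SO3 :: "mat3 set" where
  "SO3 = {R. rotation_matrix R}"

definition hat :: "vec3 \<Rightarrow> mat3" where
  "hat v = matrix (cross3 v)"

lemma hat_mult: "hat v *v w = cross3 v w"
  unfolding hat_def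
  by (rule matrix_works) (metis bilinear_cross bilinear_def linear_matrix_vector_mul_eq)

text \<open>Only meaningful on the range of \<^const>\<open>hat\<close>, i.e. on skew-symmetric matrices.\<close>

definition vee :: "mat3 \<Rightarrow> vec3" where
  "vee = inv hat"

lemma inj_hat: "inj hat"
proof (rule injI)
  fix v w :: vec3
  assume "hat v = hat w"
  then have eq: "cross3 v u = cross3 w u" for u
    by (metis hat_mult)
  show "v = w"
    using eq[of "axis 1 1"] eq[of "axis 2 1"]
    by (simp add: cross3_def vec_eq_iff forall_3 axis_def)
qed

lemma vee_hat: "vee (hat v) = v"
  by (simp add: vee_def inj_hat)

definition e3 :: vec3 where
  "e3 = axis 3 1"

text \<open>The matrix exponential is defined by its power series, because multiplication
  and \<^const>\<open>exp\<close> on the type \<^typ>\<open>mat3\<close> are not those of the matrix algebra.\<close>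

definition matrix_exp :: "mat3 \<Rightarrow> mat3" where
  "matrix_exp A = (\<Sum>n. (1 / fact n) *\<^sub>R (((**) A) ^^ n) (mat 1))"

definition Zrot :: "real \<Rightarrow> mat3" where
  "Zrot \<theta> = matrix_exp (\<theta> *\<^sub>R hat e3)"

definition inertia_matrix :: "mat3 \<Rightarrow> bool" where
  "inertia_matrix \<I> \<longleftrightarrow> transpose \<I> = \<I> \<and> (\<forall>x. x \<noteq> 0 \<longrightarrow> 0 < x \<bullet> (\<I> *v x))"

text \<open>Functions of time matter only on \<open>t \<ge> 0\<close>; all derivatives are taken within that
  half-line, hence one-sided at \<open>t = 0\<close>.\<close>

definition dot :: "(real \<Rightarrow> 'a::real_normed_vector) \<Rightarrow> real \<Rightarrow> 'a" where
  "dot f t = vector_derivative f (at t within {0..})"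

definition smooth_curve :: "(real \<Rightarrow> 'a::real_normed_vector) \<Rightarrow> bool" where
  "smooth_curve f \<longleftrightarrow>
     (\<exists>D :: nat \<Rightarrow> real \<Rightarrow> 'a. (\<forall>t\<ge>0. D 0 t = f t) \<and>
        (\<forall>n. \<forall>t\<ge>0. (D n has_vector_derivative D (Suc n) t) (at t within {0..})))"

definition reference_trajectory :: "(real \<Rightarrow> mat3) \<Rightarrow> (real \<Rightarrow> vec3) \<Rightarrow> bool" where
  "reference_trajectory Rd \<Omega>d \<longleftrightarrow>
     (\<forall>t\<ge>0. Rd t \<in> SO3) \<and> smooth_curve Rd \<and> smooth_curve \<Omega>d \<and>
     (\<forall>t\<ge>0. (Rd has_vector_derivative Rd t ** hat (\<Omega>d t)) (at t within {0..})) \<and>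
     bounded (\<Omega>d ` {0..}) \<and> bounded (dot \<Omega>d ` {0..})"

definition theta_b :: "real \<Rightarrow> real \<Rightarrow> real \<Rightarrow> real" where
  "theta_b \<theta>b0 \<gamma> t = \<theta>b0 * exp (- (\<gamma> / 2) * t)"

definition shifted_Rd :: "real \<Rightarrow> real \<Rightarrow> mat3 \<Rightarrow> (real \<Rightarrow> mat3) \<Rightarrow> real \<Rightarrow> mat3" where
  "shifted_Rd \<theta>b0 \<gamma> U0 Rd t = U0 ** Zrot (theta_b \<theta>b0 \<gamma> t) ** transpose U0 ** Rd t"

definition shifted_Omegad ::
  "real \<Rightarrow> real \<Rightarrow> mat3 \<Rightarrow> (real \<Rightarrow> mat3) \<Rightarrow> (real \<Rightarrow> vec3) \<Rightarrow> real \<Rightarrow> vec3" where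
  "shifted_Omegad \<theta>b0 \<gamma> U0 Rd \<Omega>d t =
     \<Omega>d t + dot (theta_b \<theta>b0 \<gamma>) t *\<^sub>R (transpose (shifted_Rd \<theta>b0 \<gamma> U0 Rd t) *v (U0 *v e3))"

definition err_R :: "mat3 \<Rightarrow> mat3 \<Rightarrow> vec3" where
  "err_R Rd R = (1 / 2) *\<^sub>R vee (transpose Rd ** R - transpose R ** Rd)"

definition V0 :: "real \<Rightarrow> (real \<Rightarrow> mat3) \<Rightarrow> (real \<Rightarrow> vec3) \<Rightarrow> mat3 \<Rightarrow> vec3 \<Rightarrow> real \<Rightarrow> real" where
  "V0 kR Rd \<Omega>d R \<Omega> t = kR / 4 * (norm (R - Rd t))\<^sup>2 + 1 / 2 * (norm (\<Omega> - \<Omega>d t))\<^sup>2"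

definition B_level :: "real \<Rightarrow> real \<Rightarrow> real \<Rightarrow> real \<Rightarrow> real \<Rightarrow> real" where
  "B_level kR k\<Delta> a \<mu> \<delta> =
     2 * a * ((sqrt kR - \<mu>) / (sqrt kR + \<mu>)) * kR - 1 / (2 * k\<Delta>) * \<delta>\<^sup>2"

definition control ::
  "mat3 \<Rightarrow> real \<Rightarrow> real \<Rightarrow> (real \<Rightarrow> mat3) \<Rightarrow> (real \<Rightarrow> vec3) \<Rightarrow> real \<Rightarrow> mat3 \<Rightarrow> vec3 \<Rightarrow> vec3 \<Rightarrow> vec3" where
  "control \<I> kR k\<Omega> Rd \<Omega>d t R \<Omega> \<Delta>b =
     - cross3 (\<I> *v \<Omega>) \<Omega>
     + \<I> *v (- kR *\<^sub>R err_R (Rd t) R - k\<Omega> *\<^sub>R (\<Omega> - \<Omega>d t) + cross3 \<Omega> (\<Omega>d t) + dot \<Omega>d t)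
     - \<Delta>b"

definition tracking_loop ::
  "mat3 \<Rightarrow> vec3 \<Rightarrow> real \<Rightarrow> real \<Rightarrow> real \<Rightarrow> real \<Rightarrow> (real \<Rightarrow> mat3) \<Rightarrow> (real \<Rightarrow> vec3) \<Rightarrow>
   real set \<Rightarrow> (real \<Rightarrow> mat3) \<Rightarrow> (real \<Rightarrow> vec3) \<Rightarrow> (real \<Rightarrow> vec3) \<Rightarrow> bool" where
  "tracking_loop \<I> \<Delta> kR k\<Omega> k\<Delta> \<mu> Rd \<Omega>d J R \<Omega> \<Delta>b \<longleftrightarrow>
     (\<forall>t\<in>J. R t \<in> SO3 \<and>
        (R has_vector_derivative R t ** hat (\<Omega> t)) (at t within J) \<and>
        (\<exists>\<Omega>'. (\<Omega> has_vector_derivative \<Omega>') (at t within J) \<and>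
           \<I> *v \<Omega>' = cross3 (\<I> *v \<Omega> t) (\<Omega> t)
             + control \<I> kR k\<Omega> Rd \<Omega>d t (R t) (\<Omega> t) (\<Delta>b t) + \<Delta>) \<and>
        (\<Delta>b has_vector_derivative
           k\<Delta> *\<^sub>R (matrix_inv \<I> *v ((\<Omega> t - \<Omega>d t) + \<mu> *\<^sub>R err_R (Rd t) (R t)))) (at t within J))"

text \<open>The control is selected once, from the state at time 0. The angle \<open>\<theta>0\<close> and the matrix
  \<open>U0\<close> of the second case depend on the initial attitude; any admissible \<open>U0\<close> is allowed.
  The initial estimate \<open>\<Delta>b 0\<close> is left free, as a state of the closed-loop system.\<close>

definition closed_loop ::
  "mat3 \<Rightarrow> vec3 \<Rightarrow> real \<Rightarrow> real \<Rightarrow> real \<Rightarrow> real \<Rightarrow> real \<Rightarrow> real \<Rightarrow> real \<Rightarrow> real \<Rightarrow> real \<Rightarrow>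
   (real \<Rightarrow> mat3) \<Rightarrow> (real \<Rightarrow> vec3) \<Rightarrow> real set \<Rightarrow> (real \<Rightarrow> mat3 \<times> vec3 \<times> vec3) \<Rightarrow> bool" where
  "closed_loop \<I> \<Delta> \<delta> kR k\<Omega> k\<Delta> a \<mu> \<epsilon> \<theta>b0 \<gamma> Rd \<Omega>d J x \<longleftrightarrow>
     (let R = (\<lambda>t. fst (x t)); \<Omega> = (\<lambda>t. fst (snd (x t))); \<Delta>b = (\<lambda>t. snd (snd (x t))) in
      if V0 kR Rd \<Omega>d (R 0) (\<Omega> 0) 0 \<le> B_level kR k\<Delta> a \<mu> \<delta>
      then tracking_loop \<I> \<Delta> kR k\<Omega> k\<Delta> \<mu> Rd \<Omega>d J R \<Omega> \<Delta>b
      else (\<exists>\<theta>0 U0. \<theta>0 \<in> {0..pi} \<and> U0 \<in> SO3 \<and>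
              R 0 = U0 ** Zrot \<theta>0 ** transpose U0 ** Rd 0 \<and>
              \<theta>b0 \<in> {0<..<\<theta>0} \<and>
              1 - cos (\<theta>0 - \<theta>b0)
                \<le> (2 * a * ((sqrt kR - \<mu>) / (sqrt kR + \<mu>)) - 1 / (2 * k\<Delta> * kR) * \<delta>\<^sup>2) * \<epsilon> \<and>
              tracking_loop \<I> \<Delta> kR k\<Omega> k\<Delta> \<mu>
                (shifted_Rd \<theta>b0 \<gamma> U0 Rd) (shifted_Omegad \<theta>b0 \<gamma> U0 Rd \<Omega>d) J R \<Omega> \<Delta>b))"

definition tracking_errors ::
  "vec3 \<Rightarrow> (real \<Rightarrow> mat3) \<Rightarrow> (real \<Rightarrow> vec3) \<Rightarrow> real \<Rightarrow> mat3 \<times> vec3 \<times> vec3 \<Rightarrow> mat3 \<times> vec3 \<times> vec3" where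
  "tracking_errors \<Delta> Rd \<Omega>d t = (\<lambda>(R, \<Omega>, \<Delta>b). (R - Rd t, \<Omega> - \<Omega>d t, \<Delta> - \<Delta>b))"

text \<open>\<open>X\<close> is the state space, \<open>sol J x\<close> says that \<open>x\<close> is a solution on the time interval \<open>J\<close>
  with initial time 0, and \<open>err t\<close> are error coordinates at time \<open>t\<close>. Besides Lyapunov
  stability and local attractivity of zero error, global existence of solutions from all nearby
  initial states is required; the stability bound also covers solutions that are only given on a
  bounded interval, so finite escape is not disregarded.\<close>

definition asymptotically_stable_zero ::
  "'s set \<Rightarrow> (real set \<Rightarrow> (real \<Rightarrow> 's) \<Rightarrow> bool) \<Rightarrow> (real \<Rightarrow> 's \<Rightarrow> 'e::real_normed_vector) \<Rightarrow> bool" where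
  "asymptotically_stable_zero X sol err \<longleftrightarrow>
     (\<exists>r>0. \<forall>x0\<in>X. norm (err 0 x0) < r \<longrightarrow> (\<exists>x. sol {0..} x \<and> x 0 = x0)) \<and>
     (\<forall>\<eta>>0. \<exists>r>0. \<forall>T>0. \<forall>x. sol {0..<T} x \<and> norm (err 0 (x 0)) < r \<longrightarrow>
        (\<forall>t\<in>{0..<T}. norm (err t (x t)) < \<eta>)) \<and>
     (\<exists>r>0. \<forall>x. sol {0..} x \<and> norm (err 0 (x 0)) < r \<longrightarrow>
        ((\<lambda>t. err t (x t)) \<longlongrightarrow> 0) at_top)"

end

theory Submission
  imports Defs
begin

text \<open>Since \<open>B > 0\<close>, small initial errors select the unshifted control. With
  \<open>Q = R\<^sub>d\<^sup>T R\<close> and \<open>e\<^sub>R\<close> the axial vector of the skew part of \<open>Q\<close>, the function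
  \<open>V = V\<^sub>0 + |e\<^sub>\<Delta>|\<^sup>2 / (2 k\<^sub>\<Delta>) + \<mu> e\<^sub>R \<bullet> e\<^sub>\<Omega>\<close> is comparable to the squared error, and along solutions
  \<open>V' \<le> - c (|e\<^sub>\<Omega>|\<^sup>2 + |e\<^sub>R|\<^sup>2)\<close>: the disturbance terms cancel by the adaptive law, the
  terms with \<open>\<Omega> \<times> \<Omega>\<^sub>d\<close> cancel by antisymmetry, and \<open>\<mu>\<close> is small enough for the remaining quadratic
  form. This gives stability. A Barbalat argument yields \<open>e\<^sub>\<Omega>, e\<^sub>R \<rightarrow> 0\<close>, then the velocity equation
  forces \<open>e\<^sub>\<Delta> \<rightarrow> 0\<close>, and \<open>|R - R\<^sub>d| \<le> 4 |e\<^sub>R|\<close> near the reference. Global solutions are obtained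
  from a saturated, globally Lipschitz vector field that agrees with the closed loop on the
  set which the stability estimate makes invariant.\<close>

section \<open>Global solutions of Lipschitz differential equations\<close>

text \<open>The disturbance error is absent from V', so V is merely nonincreasing, and the
  time-dependent reference makes the closed loop non-autonomous. In place of an invariance principle
  there are two limit arguments: one for the dissipated errors, and one that reads the disturbance
  error off the velocity equation. Two quadratic forms restrict \<mu>: one makes V positive
  definite, the other makes the dissipation definite. Existence looks circular, because the vector
  field is quadratic and only the stability estimate rules out escape, while that estimate speaks of
  solutions. For this reason the differential estimates are stated on arbitrary subsets of the
  half-line, with constants chosen before the solution, so that they apply to pieces of a solution
  not yet known to solve the loop globally.\<close>

lemma weighted_integral_bound:
  fixes g :: "real \<Rightarrow> 'a::banach"
  assumes "0 < K" "0 \<le> t" "0 \<le> C" "continuous_on {0..t} g"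
    and bound: "\<And>s. 0 \<le> s \<Longrightarrow> s \<le> t \<Longrightarrow> norm (g s) \<le> C * exp (K * s)"
  shows "norm (integral {0..t} g) \<le> C / K * exp (K * t)"
proof -
  \<comment> \<open>Integration reproduces the majorant \<open>C * exp (K * s)\<close> with a factor
    1 / K; this factor makes the Picard operator contract in the weighted norm.\<close>
  have "((\<lambda>s. C * exp (K * s)) has_integral (C / K * exp (K * t) - C / K * exp (K * 0))) {0..t}"
    using \<open>0 < K\<close> \<open>0 \<le> t\<close>
    by (intro fundamental_theorem_of_calculus)
      (auto intro!: derivative_eq_intros simp flip: has_real_derivative_iff_has_vector_derivative)
  then have "norm (integral {0..t} g) \<le> C / K * exp (K * t) - C / K"
    using integral_norm_bound_integral[OF integrable_continuous_real[OF \<open>continuous_on {0..t} g\<close>], of "\<lambda>s. C * exp (K * s)"] bound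
    by (auto simp: has_integral_iff)
  also have "\<dots> \<le> C / K * exp (K * t)"
    using assms by simp
  finally show ?thesis .
qed

text \<open>The Picard operator is a contraction for the weighted norm \<open>sup |exp (- 2 L t) x t|\<close>; the
  fixed point below is the weighted solution, extended constantly to negative times.\<close>

lemma lipschitz_ode_global_solution:
  fixes f :: "real \<Rightarrow> 'a::euclidean_space \<Rightarrow> 'a"
  assumes cont: "continuous_on ({0..} \<times> UNIV) (\<lambda>p. f (fst p) (snd p))"
    and lip: "\<And>t x y. 0 \<le> t \<Longrightarrow> norm (f t x - f t y) \<le> L * norm (x - y)"
    and bdd: "\<And>t. 0 \<le> t \<Longrightarrow> norm (f t 0) \<le> C"
    and "0 < L"
  shows "\<exists>x. x 0 = x0 \<and> (\<forall>t\<ge>0. (x has_vector_derivative f t (x t)) (at t within {0..}))"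
proof -
  define K where "K = 2 * L"
  have K: "0 < K" using \<open>0 < L\<close> by (simp add: K_def)
  \<comment> \<open>\<open>u\<close> encodes the curve \<open>exp (K * s) *\<^sub>R u s\<close>;
    \<open>rhs\<close> is the vector field along it, and \<open>P\<close> is its Picard iterate with
    the weight divided out.\<close>
  define rhs where "rhs u s = f s (exp (K * s) *\<^sub>R apply_bcontfun u s)" for u :: "real \<Rightarrow>\<^sub>C 'a" and s
  define P where "P u t = exp (- K * t) *\<^sub>R (x0 + integral {0..t} (rhs u))" for u t
  have rhs_cont: "continuous_on {0..} (rhs u)" for u
  proof -
    have "continuous_on {0..} (\<lambda>s. (s, exp (K * s) *\<^sub>R apply_bcontfun u s))"
      by (intro continuous_intros continuous_on_apply_bcontfun)
    from continuous_on_compose2[OF cont this] show ?thesis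
      by (auto simp: rhs_def)
  qed
  have rhs_cont': "continuous_on {0..t} (rhs u)" for t u
    by (rule continuous_on_subset[OF rhs_cont]) auto
  have int_deriv: "((\<lambda>t. integral {0..t} (rhs u)) has_vector_derivative rhs u t) (at t within {0..})"
    if "0 \<le> t" for u t
  proof -
    have "((\<lambda>t. integral {0..t} (rhs u)) has_vector_derivative rhs u t) (at t within {0..t+1})"
      by (rule integral_has_vector_derivative[OF rhs_cont']) (use that in auto)
    \<comment> \<open>The interval extends past t, so it agrees with the half-line near t, also at t
      = 0.\<close>
    moreover have "at t within {0..t+1} = at t within {0..}"
      by (rule at_within_nhd[where S="{..<t+1}"]) auto
    ultimately show ?thesis by simp
  qed
  have P_cont: "continuous_on {0..} (P u)" for u
  proof -
    have "continuous_on {0..} (\<lambda>t. integral {0..t} (rhs u))"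
      by (auto simp: continuous_on_eq_continuous_within
          intro!: has_vector_derivative_continuous int_deriv)
    then show ?thesis
      unfolding P_def by (intro continuous_intros)
  qed
  have P_bdd: "bounded (P u ` {0..})" for u
  proof -
    obtain N where N: "\<And>s. norm (apply_bcontfun u s) \<le> N"
      using bounded_apply_bcontfun[of u] by (auto simp: bounded_iff)
    have N0: "0 \<le> N" using N[of 0] norm_ge_zero order_trans by blast
    have C0: "0 \<le> C" using bdd[of 0] norm_ge_zero order_trans by blast
    have "norm (P u t) \<le> norm x0 + (L * N + C) / K" if "0 \<le> t" for t
    proof -
      have "norm (rhs u s) \<le> (L * N + C) * exp (K * s)" if "0 \<le> s" for s
      proof -
        have "norm (rhs u s) \<le> norm (rhs u s - f s 0) + norm (f s 0)"
          using norm_triangle_ineq[of "rhs u s - f s 0" "f s 0"] by simp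
        also have "\<dots> \<le> L * (exp (K * s) * norm (apply_bcontfun u s)) + C"
          using lip[OF that, of "exp (K * s) *\<^sub>R apply_bcontfun u s" 0] bdd[OF that] by (auto simp: rhs_def)
        also have "\<dots> \<le> L * (exp (K * s) * N) + C * exp (K * s)"
          using N[of s] \<open>0 < L\<close> C0 K that mult_left_mono[of 1 "exp (K * s)" C] by (intro add_mono mult_left_mono) auto
        finally show ?thesis by (simp add: algebra_simps)
      qed
      then have "norm (integral {0..t} (rhs u)) \<le> (L * N + C) / K * exp (K * t)"
        using K \<open>0 \<le> t\<close> N0 C0 \<open>0 < L\<close> by (intro weighted_integral_bound rhs_cont') auto
      then have "exp (- K * t) * norm (integral {0..t} (rhs u)) \<le> exp (- K * t) * ((L * N + C) / K * exp (K * t))"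
        by (intro mult_left_mono) auto
      also have "\<dots> = (L * N + C) / K"
        by (simp add: exp_minus)
      finally have "exp (- K * t) * norm (integral {0..t} (rhs u)) \<le> (L * N + C) / K" .
      moreover have "exp (- K * t) * norm x0 \<le> norm x0"
        using K \<open>0 \<le> t\<close> by (intro mult_left_le_one_le) auto
      moreover have "norm (P u t) \<le> exp (- K * t) * norm x0 + exp (- K * t) * norm (integral {0..t} (rhs u))"
        unfolding P_def by (simp add: norm_triangle_ineq flip: distrib_left)
      ultimately show ?thesis by linarith
    qed
    then show ?thesis unfolding bounded_iff by blast
  qed
  have P_bcont: "(\<lambda>t. P u (max 0 t)) \<in> bcontfun" for u
  proof -
    have "continuous_on UNIV (\<lambda>t. P u (max 0 t))"
      by (rule continuous_on_compose2[OF P_cont]) (auto intro!: continuous_intros)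
    moreover have "bounded (range (\<lambda>t. P u (max 0 t)))"
      by (rule bounded_subset[OF P_bdd]) auto
    ultimately show ?thesis by (simp add: bcontfun_def)
  qed
  define \<Phi> where "\<Phi> u = Bcontfun (\<lambda>t. P u (max 0 t))" for u
  have \<Phi>: "apply_bcontfun (\<Phi> u) t = P u (max 0 t)" for u t
    unfolding \<Phi>_def using Bcontfun_inverse[OF P_bcont] by simp
  have "dist (\<Phi> u) (\<Phi> v) \<le> 1/2 * dist u v" for u v
  proof (rule dist_bound)
    fix r :: real
    define t where "t = max 0 r"
    have t: "0 \<le> t" by (simp add: t_def)
    have "norm (rhs u s - rhs v s) \<le> (L * dist u v) * exp (K * s)" if "0 \<le> s" for s
    proof -
      have "norm (rhs u s - rhs v s) \<le> L * norm (exp (K * s) *\<^sub>R (apply_bcontfun u s - apply_bcontfun v s))"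
        using lip[OF that] by (simp add: rhs_def scaleR_diff_right)
      also have "\<dots> \<le> L * (exp (K * s) * dist u v)"
        using dist_bounded[of u s v] \<open>0 < L\<close> by (simp add: dist_norm)
      finally show ?thesis by (simp add: algebra_simps)
    qed
    then have "norm (integral {0..t} (\<lambda>s. rhs u s - rhs v s)) \<le> (L * dist u v) / K * exp (K * t)"
      using K t \<open>0 < L\<close> by (intro weighted_integral_bound continuous_on_diff rhs_cont') auto
    then have "exp (- K * t) * norm (integral {0..t} (\<lambda>s. rhs u s - rhs v s))
        \<le> exp (- K * t) * ((L * dist u v) / K * exp (K * t))"
      by (intro mult_left_mono) auto
    \<comment> \<open>The contraction factor is L / K, which is 1 / 2 by the choice K = 2 L.\<close>
    also have "\<dots> = 1/2 * dist u v"
      using \<open>0 < L\<close> by (simp add: exp_minus K_def)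
    also have "exp (- K * t) * norm (integral {0..t} (\<lambda>s. rhs u s - rhs v s)) = dist (P u t) (P v t)"
      unfolding P_def dist_norm
      by (simp add: integral_diff integrable_continuous_real rhs_cont' flip: scaleR_diff_right)
    finally show "dist (apply_bcontfun (\<Phi> u) r) (apply_bcontfun (\<Phi> v) r) \<le> 1/2 * dist u v"
      unfolding \<Phi> t_def .
  qed
  then obtain u where u: "\<Phi> u = u"
    using banach_fix_type[of "1/2" \<Phi>] by auto
  define x where "x t = x0 + integral {0..t} (rhs u)" for t
  have "apply_bcontfun u t = P u t" if "0 \<le> t" for t
    using \<Phi>[of u t] u that by (simp add: max_def)
  then have "rhs u t = f t (x t)" if "0 \<le> t" for t
    using that by (simp add: rhs_def P_def x_def flip: exp_add)
  then have "(x has_vector_derivative f t (x t)) (at t within {0..})" if "0 \<le> t" for t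
    unfolding x_def using int_deriv[OF that] that
    by (auto intro!: derivative_eq_intros simp: x_def)
  moreover have "x 0 = x0" by (simp add: x_def)
  ultimately show ?thesis by blast
qed

section \<open>The Frobenius inner product and rotation matrices\<close>

lemma inner_matrix_sum: "A \<bullet> B = (\<Sum>i\<in>UNIV. \<Sum>j\<in>UNIV. A $ i $ j * B $ i $ j)"
  for A B :: "real^'n^'m"
  by (simp add: inner_vec_def)

lemma inner_matrix_trace: "A \<bullet> B = trace (transpose A ** B)"
  for A B :: "real^'n^'m"
  unfolding inner_matrix_sum trace_def matrix_matrix_mult_def transpose_def
  by simp (rule sum.swap)

lemma inner_transpose_transpose: "transpose A \<bullet> transpose B = A \<bullet> B"
  for A B :: "real^'n^'m"
  unfolding inner_matrix_sum transpose_def by simp (rule sum.swap)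

lemma norm_transpose: "norm (transpose A) = norm A"
  for A :: "real^'n^'m"
  by (simp add: norm_eq_sqrt_inner inner_transpose_transpose)

lemma inner_matrix_mult_left: "(A ** B) \<bullet> C = B \<bullet> (transpose A ** C)"
  for A :: "real^'n^'m" and B :: "real^'k^'n"
  by (simp add: inner_matrix_trace matrix_transpose_mul matrix_mul_assoc)

lemma inner_matrix_mult_right: "(A ** B) \<bullet> C = A \<bullet> (C ** transpose B)"
  for A :: "real^'n^'m" and B :: "real^'k^'n"
proof -
  have "(A ** B) \<bullet> C = (transpose B ** transpose A) \<bullet> transpose C"
    by (metis inner_transpose_transpose matrix_transpose_mul)
  also have "\<dots> = transpose A \<bullet> transpose (C ** transpose B)"
    by (simp add: inner_matrix_mult_left matrix_transpose_mul)
  finally show ?thesis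
    by (simp add: inner_transpose_transpose)
qed

text \<open>Cauchy-Schwarz in each row: the Frobenius norm dominates the operator norm.\<close>

lemma norm_matrix_vector_mult_le: "norm (A *v x) \<le> norm A * norm x"
  for A :: "real^'n^'m"
proof -
  have "(norm (A *v x))\<^sup>2 = (\<Sum>i\<in>UNIV. (A $ i \<bullet> x)\<^sup>2)"
    unfolding power2_norm_eq_inner
    by (simp add: inner_vec_def matrix_vector_mult_def power2_eq_square)
  also have "\<dots> \<le> (\<Sum>i\<in>UNIV. (norm (A $ i))\<^sup>2 * (norm x)\<^sup>2)"
    by (intro sum_mono) (metis Cauchy_Schwarz_ineq power2_norm_eq_inner)
  also have "\<dots> = (norm A * norm x)\<^sup>2"
    by (simp add: power_mult_distrib sum_distrib_right power2_norm_eq_inner inner_vec_def)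
  finally show ?thesis
    by (rule power2_le_imp_le) simp
qed

lemma norm_matrix_mult_le: "norm (A ** B) \<le> norm A * norm B"
  for A :: "real^'n^'m" and B :: "real^'k^'n"
proof -
  have row: "(A ** B) $ i = transpose B *v (A $ i)" for i
    by (simp add: vec_eq_iff matrix_matrix_mult_def matrix_vector_mult_def transpose_def mult.commute)
  have "(norm (A ** B))\<^sup>2 = (\<Sum>i\<in>UNIV. (norm ((A ** B) $ i))\<^sup>2)"
    by (simp add: power2_norm_eq_inner inner_vec_def)
  also have "\<dots> \<le> (\<Sum>i\<in>UNIV. (norm B * norm (A $ i))\<^sup>2)"
    unfolding row
    by (intro sum_mono power_mono) (use norm_matrix_vector_mult_le norm_transpose in metis, simp)
  also have "\<dots> = (norm A * norm B)\<^sup>2"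
    by (simp add: power_mult_distrib sum_distrib_right power2_norm_eq_inner inner_vec_def mult.commute
        flip: sum_distrib_left)
  finally show ?thesis
    by (rule power2_le_imp_le) simp
qed

lemma bounded_bilinear_matrix_mult: "bounded_bilinear ((**) :: real^'n^'m \<Rightarrow> real^'k^'n \<Rightarrow> real^'k^'m)"
proof (rule bounded_bilinear.intro)
  show "\<exists>K. \<forall>(A::real^'n^'m) (B::real^'k^'n). norm (A ** B) \<le> norm A * norm B * K"
    by (intro exI[of _ 1]) (simp add: norm_matrix_mult_le)
qed (simp_all add: matrix_add_ldistrib matrix_matrix_mult_def vec_eq_iff algebra_simps
    sum.distrib sum_distrib_left)

lemma bounded_linear_transpose: "bounded_linear (transpose :: real^'n^'m \<Rightarrow> real^'m^'n)"
  by (rule bounded_linear_intro[where K=1])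
    (simp_all add: norm_transpose, simp_all add: transpose_def vec_eq_iff)

lemma bounded_bilinear_cross3: "bounded_bilinear cross3"
  using bilinear_cross bilinear_conv_bounded_bilinear by blast

lemma norm_cross3_le: "norm (cross3 x y) \<le> norm x * norm y"
  by (metis norm_cross_dot le_add_same_cancel1 mult_nonneg_nonneg norm_ge_zero power2_le_imp_le zero_le_power2)

lemmas matrix_mult_simps = bounded_bilinear.diff_left[OF bounded_bilinear_matrix_mult]
  bounded_bilinear.diff_right[OF bounded_bilinear_matrix_mult]
  bounded_bilinear.minus_left[OF bounded_bilinear_matrix_mult]
  bounded_bilinear.minus_right[OF bounded_bilinear_matrix_mult]
  bounded_bilinear.scaleR_left[OF bounded_bilinear_matrix_mult]
  bounded_bilinear.scaleR_right[OF bounded_bilinear_matrix_mult]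
  linear_diff[OF bounded_linear.linear[OF bounded_linear_transpose]]
  matrix_transpose_mul

section \<open>The hat map and its adjoint\<close>

lemma hat_components:
  "hat v $ 1 $ 1 = 0" "hat v $ 1 $ 2 = - v $ 3" "hat v $ 1 $ 3 = v $ 2"
  "hat v $ 2 $ 1 = v $ 3" "hat v $ 2 $ 2 = 0" "hat v $ 2 $ 3 = - v $ 1"
  "hat v $ 3 $ 1 = - v $ 2" "hat v $ 3 $ 2 = v $ 1" "hat v $ 3 $ 3 = 0"
  by (simp_all add: hat_def matrix_def cross3_def axis_def)

lemma transpose_hat: "transpose (hat v) = - hat v"
  by (simp add: vec_eq_iff forall_3 transpose_def hat_components)

lemma inner_hat_hat: "hat v \<bullet> hat w = 2 * (v \<bullet> w)"
  by (simp add: inner_vec_def sum_3 hat_components)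

text \<open>Each component of v occurs twice in \<open>hat v\<close>; this 2 is the source of the
  constant sqrt 2 that relates \<open>err_R\<close> to the attitude distance.\<close>

lemma norm_hat: "(norm (hat v))\<^sup>2 = 2 * (norm v)\<^sup>2"
  by (simp add: power2_norm_eq_inner inner_hat_hat)

lemma norm_hat_le: "norm (hat v) \<le> 2 * norm v"
proof (rule power2_le_imp_le)
  show "(norm (hat v))\<^sup>2 \<le> (2 * norm v)\<^sup>2"
    by (simp add: norm_hat power_mult_distrib)
qed simp

lemma bounded_linear_hat: "bounded_linear hat"
  by (rule bounded_linear_intro[where K=2])
    (simp_all add: norm_hat_le[unfolded mult.commute[of 2]], simp_all add: vec_eq_iff forall_3 hat_components)

lemma inner_transpose_hat: "transpose A \<bullet> hat v = - (A \<bullet> hat v)"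
  using inner_transpose_transpose[of A "hat v"] by (simp add: transpose_hat)

lemma inner_mat1_hat: "mat 1 \<bullet> hat v = 0"
  using inner_transpose_hat[of "mat 1" v] by simp

text \<open>\<open>axial A\<close> is the axial vector of the skew part of \<open>A\<close>, i.e. half the adjoint of
  \<^const>\<open>hat\<close>. It makes the attitude error a linear function of \<open>transpose Rd ** R\<close>.\<close>

definition axial :: "mat3 \<Rightarrow> vec3" where
  "axial A = (1 / 2) *\<^sub>R vector [A $ 3 $ 2 - A $ 2 $ 3, A $ 1 $ 3 - A $ 3 $ 1, A $ 2 $ 1 - A $ 1 $ 2]"

lemma hat_axial: "hat (axial A) = (1 / 2) *\<^sub>R (A - transpose A)"
  by (simp add: vec_eq_iff forall_3 hat_components axial_def transpose_def algebra_simps)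

lemma inner_axial: "axial A \<bullet> v = 1 / 2 * (A \<bullet> hat v)"
  by (simp add: inner_vec_def sum_3 hat_components axial_def field_simps)

lemma err_R_axial: "err_R Rd R = axial (transpose Rd ** R)"
proof -
  have "transpose Rd ** R - transpose R ** Rd = hat (2 *\<^sub>R axial (transpose Rd ** R))"
    by (simp add: linear_cmul[OF bounded_linear.linear[OF bounded_linear_hat]] hat_axial matrix_transpose_mul)
  then show ?thesis
    by (simp add: err_R_def vee_hat)
qed

text \<open>\<open>hat (axial A)\<close> is the orthogonal projection of A onto the skew matrices,
  hence no longer than A; the 2 is that of \<open>norm_hat\<close>.\<close>

lemma norm_axial_le: "2 * (norm (axial A))\<^sup>2 \<le> (norm A)\<^sup>2"
proof -
  have "2 * (norm (axial A))\<^sup>2 = A \<bullet> hat (axial A)"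
    by (simp add: power2_norm_eq_inner inner_axial)
  also have "\<dots> \<le> norm A * norm (hat (axial A))"
    by (rule norm_cauchy_schwarz)
  finally have *: "(norm (hat (axial A)))\<^sup>2 \<le> norm A * norm (hat (axial A))"
    by (simp add: norm_hat)
  have "norm (hat (axial A)) \<le> norm A"
    using * by (cases "hat (axial A) = 0") (auto simp: power2_eq_square)
  then show ?thesis
    by (metis norm_hat norm_ge_zero power_mono)
qed

lemma norm_axial_le': "norm (axial A) \<le> norm A"
  using norm_axial_le[of A] by (smt (verit) norm_ge_zero power2_le_imp_le zero_le_power2)

lemma bounded_linear_axial: "bounded_linear axial"
  by (rule bounded_linear_intro[where K=1])
    (simp_all add: norm_axial_le', simp_all add: vec_eq_iff forall_3 axial_def algebra_simps)

text \<open>The symmetric part of A has a symmetric commutator with \<open>hat w\<close>, which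
  \<open>axial\<close> kills; on skew matrices the identity says that the hat map respects Lie
  brackets. It turns the motion of the reference into a rotation of the attitude error.\<close>

lemma axial_commutator_hat: "axial (A ** hat w - hat w ** A) = cross3 (axial A) w"
  by (simp add: vec_eq_iff forall_3 axial_def cross3_def matrix_matrix_mult_def sum_3 hat_components
      algebra_simps)

section \<open>Rotations and the relative attitude\<close>

lemma SO3_orthogonal:
  assumes "R \<in> SO3"
  shows "transpose R ** R = mat 1" "R ** transpose R = mat 1"
  using assms by (auto simp: SO3_def rotation_matrix_def orthogonal_matrix_def)

lemma norm_SO3_mult:
  assumes "R \<in> SO3"
  shows "norm (R ** A) = norm A" and "norm (transpose R ** A) = norm A"
  by (simp_all add: norm_eq_sqrt_inner inner_matrix_mult_left matrix_mul_assoc SO3_orthogonal[OF assms])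

text \<open>The exact value is sqrt 3; the rounder bound 2 is the level at which
  \<open>saturated_field\<close> truncates attitudes.\<close>

lemma norm_SO3: "R \<in> SO3 \<Longrightarrow> norm R \<le> 2"
  by (rule power2_le_imp_le)
    (simp_all add: norm_matrix_trace SO3_orthogonal trace_def sum_3 mat_def)

lemma relative_attitude_orthogonal:
  assumes "R \<in> SO3" "S \<in> SO3"
  shows "transpose (transpose S ** R) ** (transpose S ** R) = mat 1"
proof -
  have "transpose (transpose S ** R) ** (transpose S ** R) = transpose R ** (S ** transpose S) ** R"
    by (simp only: matrix_transpose_mul matrix_mul_assoc transpose_transpose)
  then show ?thesis
    using assms by (simp add: SO3_orthogonal)
qed

lemma norm_relative_attitude:
  assumes "S \<in> SO3"
  shows "norm (transpose S ** R - mat 1) = norm (R - S)"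
proof -
  have "transpose S ** R - mat 1 = transpose S ** (R - S)"
    by (simp add: matrix_mult_simps SO3_orthogonal[OF assms])
  then show ?thesis
    by (simp add: norm_SO3_mult[OF assms])
qed

lemma axial_mat1: "axial (mat 1) = 0"
  by (simp add: axial_def vec_eq_iff forall_3 mat_def)

text \<open>Subtracting the identity from the relative attitude keeps its axial vector and turns its
  norm into the attitude distance.\<close>

lemma norm_err_R_le:
  assumes "S \<in> SO3"
  shows "2 * (norm (err_R S R))\<^sup>2 \<le> (norm (R - S))\<^sup>2"
proof -
  have "err_R S R = axial (transpose S ** R - mat 1)"
    by (simp add: err_R_axial linear_diff[OF bounded_linear.linear[OF bounded_linear_axial]] axial_mat1)
  then show ?thesis
    using norm_axial_le norm_relative_attitude[OF assms] by metis
qed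

text \<open>For \<open>Q = I + F\<close> orthogonal, \<open>F + F\<^sup>T = - F\<^sup>T F\<close>, so the symmetric part of \<open>F\<close> is of
  second order.\<close>

lemma norm_le_err_R:
  assumes "R \<in> SO3" "S \<in> SO3" "norm (R - S) \<le> 1"
  shows "norm (R - S) \<le> 4 * norm (err_R S R)"
proof -
  define F where "F = transpose S ** R - mat 1"
  have nF: "norm F = norm (R - S)"
    by (simp add: F_def norm_relative_attitude assms)
  have "transpose S ** R = mat 1 + F"
    by (simp add: F_def)
  with relative_attitude_orthogonal[OF assms(1,2)]
  have "transpose (mat 1 + F) ** (mat 1 + F) = mat 1"
    by metis
  then have "F + transpose F + transpose F ** F = 0"
    by (simp add: linear_add[OF bounded_linear.linear[OF bounded_linear_transpose]] matrix_add_ldistrib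
      bounded_bilinear.add_left[OF bounded_bilinear_matrix_mult] algebra_simps)
  then have sym: "F + transpose F = - (transpose F ** F)"
    by (simp add: eq_neg_iff_add_eq_0)
  have "hat (err_R S R) = (1/2) *\<^sub>R (F - transpose F)"
    by (simp add: err_R_axial hat_axial F_def matrix_mult_simps)
  also have "\<dots> = F - (1/2) *\<^sub>R (F + transpose F)"
    by (simp add: algebra_simps flip: scaleR_left.add)
  finally have "F = hat (err_R S R) + (1/2) *\<^sub>R (F + transpose F)"
    by simp
  then have "norm F \<le> norm (hat (err_R S R)) + 1/2 * norm (transpose F ** F)"
    unfolding sym by (metis norm_triangle_ineq norm_scaleR norm_minus_cancel abs_of_pos half_gt_zero_iff zero_less_one)
  \<comment> \<open>As |F| is at most 1, the quadratic term is at most |F|, and half of it is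
    absorbed: |F| <= 2 |e_R| + |F| / 2, hence the constant 4.\<close>
  moreover have "norm (transpose F ** F) \<le> norm F"
    using norm_matrix_mult_le[of "transpose F" F] assms nF mult_left_le[of "norm F" "norm F"]
    by (simp add: norm_transpose)
  moreover have "norm (hat (err_R S R)) \<le> 2 * norm (err_R S R)"
    by (rule norm_hat_le)
  ultimately show ?thesis
    unfolding nF by linarith
qed

section \<open>Convergence from dissipation\<close>

lemma mean_value_half_line:
  fixes f :: "real \<Rightarrow> real"
  assumes "\<And>t. 0 \<le> t \<Longrightarrow> (f has_vector_derivative f' t) (at t within {0..})" "0 \<le> a" "a \<le> b"
  shows "\<exists>s\<in>{a..b}. f b - f a = (b - a) * f' s"
proof -
  have "(f has_derivative (\<lambda>h. h *\<^sub>R f' s)) (at s within {a..b})" if "a \<le> s" "s \<le> b" for s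
    using has_vector_derivative_within_subset[OF assms(1), of s "{a..b}"] that assms(2)
    by (simp add: has_vector_derivative_def)
  from mvt_very_simple[OF \<open>a \<le> b\<close> this] show ?thesis by simp
qed

lemma norm_increment_half_line:
  fixes f :: "real \<Rightarrow> 'a::real_normed_vector"
  assumes f': "\<And>t. 0 \<le> t \<Longrightarrow> (f has_vector_derivative f' t) (at t within {0..})" and "0 \<le> a" "a \<le> b"
    and bound: "\<And>s. a \<le> s \<Longrightarrow> s \<le> b \<Longrightarrow> norm (f' s) \<le> B"
  shows "norm (f b - f a) \<le> B * (b - a)"
proof -
  have "norm (f b - f a) \<le> B * norm (b - a)"
  proof (rule differentiable_bound[of "{a..b}" f "\<lambda>s h. h *\<^sub>R f' s"])
    show "(f has_derivative (\<lambda>h. h *\<^sub>R f' s)) (at s within {a..b})" if "s \<in> {a..b}" for s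
      using has_vector_derivative_within_subset[OF f', of s "{a..b}"] that assms(2)
      by (auto simp: has_vector_derivative_def)
    show "onorm (\<lambda>h. h *\<^sub>R f' s) \<le> B" if "s \<in> {a..b}" for s
    proof (rule onorm_bound)
      have "norm (f' s) \<le> B" using that bound by auto
      then show "0 \<le> B" and "norm (h *\<^sub>R f' s) \<le> B * norm h" for h
        using norm_ge_zero order_trans by (blast, simp add: mult.commute[of B] mult_left_mono)
    qed
  qed (use assms in auto)
  with \<open>a \<le> b\<close> show ?thesis by simp
qed

text \<open>A form of Barbalat's lemma: if \<open>W\<close> is large at \<open>t\<close>, it stays large for a time
  proportional to \<open>W t\<close>, which costs \<open>V\<close> an amount of order \<open>(W t)\<^sup>2\<close>.\<close>

lemma dissipation_tendsto_zero:
  fixes V W :: "real \<Rightarrow> real"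
  assumes V: "\<And>t. 0 \<le> t \<Longrightarrow> (V has_vector_derivative V' t) (at t within {0..})"
    and W: "\<And>t. 0 \<le> t \<Longrightarrow> (W has_vector_derivative W' t) (at t within {0..})"
    and V': "\<And>t. 0 \<le> t \<Longrightarrow> V' t \<le> - c * W t"
    and W': "\<And>t. 0 \<le> t \<Longrightarrow> \<bar>W' t\<bar> \<le> M"
    and pos: "\<And>t. 0 \<le> t \<Longrightarrow> 0 \<le> V t" "\<And>t. 0 \<le> t \<Longrightarrow> 0 \<le> W t"
    and "0 < c" "0 < M"
  shows "(W \<longlongrightarrow> 0) at_top"
proof -
  have cost: "c * (W t)\<^sup>2 / (4 * M) \<le> V t - V (t + W t / (2 * M))" if t0: "0 \<le> t" for t
  proof -
    \<comment> \<open>W has slope at most M, so within time h it cannot fall below half its value at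
      t.\<close>
    define h where "h = W t / (2 * M)"
    have h: "0 \<le> h" "M * h = W t / 2"
      using pos(2)[OF that] \<open>0 < M\<close> by (simp_all add: h_def)
    obtain s where s: "t \<le> s" "s \<le> t + h" "V (t + h) - V t = h * V' s"
      using mean_value_half_line[of V V' t "t + h"] V t0 h by auto
    obtain r where r: "t \<le> r" "r \<le> s" "W s - W t = (s - t) * W' r"
      using mean_value_half_line[of W W' t s] W t0 s by auto
    have "\<bar>W s - W t\<bar> \<le> h * M"
      unfolding r(3) abs_mult using s r W'[of r] that h by (intro mult_mono) auto
    with h have "W t / 2 \<le> W s" by (simp add: mult.commute abs_le_iff)
    then have "c * (W t / 2) \<le> c * W s"
      using \<open>0 < c\<close> by simp
    then have "V' s \<le> - c * (W t / 2)"
      using V'[of s] s that by simp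
    then have "V (t + h) - V t \<le> h * (- c * (W t / 2))"
      unfolding s(3) using h by (intro mult_left_mono)
    then show ?thesis
      unfolding h_def by (simp add: power2_eq_square mult_ac)
  qed
  have anti: "V b \<le> V a" if ab: "0 \<le> a" "a \<le> b" for a b
  proof -
    obtain s where s: "a \<le> s" "V b - V a = (b - a) * V' s"
      using mean_value_half_line[of V V' a b] V ab by auto
    have "0 \<le> c * W s"
      using pos(2)[of s] s that \<open>0 < c\<close> by simp
    then have "(b - a) * V' s \<le> 0"
      using V'[of s] s that by (intro mult_nonneg_nonpos) auto
    with s show ?thesis by simp
  qed
  define L where "L = Inf (V ` {0..})"
  have bdd: "bdd_below (V ` {0..})"
    using pos(1) by (auto simp: bdd_below_def)
  have L: "L \<le> V t" if "0 \<le> t" for t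
    unfolding L_def by (rule cInf_lower[OF _ bdd]) (use that in auto)
  show ?thesis
  proof (rule tendstoI)
    fix e :: real assume "0 < e"
    \<comment> \<open>d is the loss of V that a value W t = e would force; once V is within d of its
      infimum, W stays below e.\<close>
    define d where "d = c * e\<^sup>2 / (4 * M)"
    have "0 < d" using \<open>0 < e\<close> \<open>0 < c\<close> \<open>0 < M\<close> by (simp add: d_def)
    have "\<exists>v\<in>V ` {0..}. v < L + d"
      unfolding L_def by (rule cInf_lessD) (use \<open>0 < d\<close> in auto)
    then obtain T where T: "0 \<le> T" "V T < L + d"
      by auto
    have "dist (W t) 0 < e" if "T \<le> t" for t
    proof -
      have t: "0 \<le> t" using T that by simp
      then have "0 \<le> W t / (2 * M)" using pos(2) \<open>0 < M\<close> by simp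
      then have "c * (W t)\<^sup>2 / (4 * M) < d"
        using cost[OF t] L[of "t + W t / (2 * M)"] anti[OF T(1) that] T(2) t by linarith
      then have "(W t)\<^sup>2 < e\<^sup>2"
        using \<open>0 < c\<close> \<open>0 < M\<close> by (simp add: d_def field_simps)
      then show ?thesis
        using \<open>0 < e\<close> pos(2)[OF t] by (simp add: power_less_imp_less_base)
    qed
    then show "\<forall>\<^sub>F t in at_top. dist (W t) 0 < e"
      using eventually_at_top_linorder by blast
  qed
qed

text \<open>Because z' vanishes in the limit, z is nearly constant on [t, t + 1], so the increment
  of y there is z t up to a vanishing error. The increment itself vanishes, hence so does z.\<close>

lemma slow_forcing_tendsto_zero:
  fixes y b z :: "real \<Rightarrow> 'a::real_normed_vector"
  assumes y': "\<And>t. 0 \<le> t \<Longrightarrow> (y has_vector_derivative b t + z t) (at t within {0..})"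
    and z': "\<And>t. 0 \<le> t \<Longrightarrow> (z has_vector_derivative z' t) (at t within {0..})"
    and lims: "(y \<longlongrightarrow> 0) at_top" "(b \<longlongrightarrow> 0) at_top" "(z' \<longlongrightarrow> 0) at_top"
  shows "(z \<longlongrightarrow> 0) at_top"
proof (rule tendstoI)
  fix e' :: real assume "0 < e'"
  \<comment> \<open>Four errors of size e add up: y at both ends, b, and the variation of z over
    unit time. The fifth share makes the inequality strict.\<close>
  define e where "e = e' / 5"
  have "0 < e" using \<open>0 < e'\<close> by (simp add: e_def)
  have "\<forall>\<^sub>F t in at_top. norm (y t) < e \<and> norm (b t) < e \<and> norm (z' t) < e"
    using lims[THEN tendstoD, OF \<open>0 < e\<close>] by (simp add: eventually_conj)
  then obtain T0 where T0: "\<And>t. T0 \<le> t \<Longrightarrow> norm (y t) < e \<and> norm (b t) < e \<and> norm (z' t) < e"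
    using eventually_at_top_linorder[of "\<lambda>t. norm (y t) < e \<and> norm (b t) < e \<and> norm (z' t) < e"] by auto
  have "dist (z t) 0 < e'" if "max 0 T0 \<le> t" for t
  proof -
    have t: "0 \<le> t" "T0 \<le> t" using that by auto
    \<comment> \<open>Removing the drift frozen at time t leaves a function with derivative at most
      2 e on [t, t + 1].\<close>
    define \<phi> where "\<phi> s = y s - s *\<^sub>R z t" for s
    have "norm (z s - z t) \<le> e" if "t \<le> s" "s \<le> t + 1" for s
    proof -
      have "norm (z s - z t) \<le> e * (s - t)"
        using T0 t that by (intro norm_increment_half_line[of z z'] z') (auto intro: less_imp_le)
      also have "\<dots> \<le> e * 1"
        using that \<open>0 < e\<close> by (intro mult_left_mono) auto
      finally show ?thesis by simp
    qed
    moreover have "norm (b s + (z s - z t)) \<le> norm (b s) + norm (z s - z t)" for s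
      by (rule norm_triangle_ineq)
    ultimately have "norm (b s + (z s - z t)) \<le> 2 * e" if "t \<le> s" "s \<le> t + 1" for s
      using T0[of s] that t by (smt (verit))
    moreover have "(\<phi> has_vector_derivative b s + (z s - z t)) (at s within {0..})" if "0 \<le> s" for s
      unfolding \<phi>_def by (auto intro!: derivative_eq_intros y' that)
    ultimately have "norm (\<phi> (t + 1) - \<phi> t) \<le> 2 * e * (t + 1 - t)"
      using t by (intro norm_increment_half_line) auto
    then have "norm (y (t + 1) - y t - z t) \<le> 2 * e"
      by (simp add: \<phi>_def algebra_simps)
    moreover have "norm (y (t + 1)) < e" "norm (y t) < e"
      using T0[of "t + 1"] T0[of t] t by auto
    moreover have "norm (z t) \<le> norm (y (t + 1)) + norm (y t) + norm (y (t + 1) - y t - z t)"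
      using norm_triangle_ineq4[of "y (t + 1) - y t" "y (t + 1) - y t - z t"]
        norm_triangle_ineq4[of "y (t + 1)" "y t"] by simp
    ultimately show ?thesis
      using \<open>0 < e\<close> by (simp add: e_def)
  qed
  then show "\<forall>\<^sub>F t in at_top. dist (z t) 0 < e'"
    using eventually_at_top_linorder by blast
qed

lemma quadratic_form_coercive:
  fixes p q b :: real
  assumes "0 < p" "0 < q" "b\<^sup>2 < 4 * p * q"
  obtains c where "0 < c" "\<And>x y. c * (x\<^sup>2 + y\<^sup>2) \<le> p * x\<^sup>2 + q * y\<^sup>2 + b * x * y"
proof -
  \<comment> \<open>Determinant over trace of the symmetric matrix of the form. For positive
    eigenvalues l1, l2 this is l1 l2 / (l1 + l2), which is below both.\<close>
  define c where "c = (4 * p * q - b\<^sup>2) / (4 * (p + q))"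
  have "0 < c" using assms by (simp add: c_def)
  have c: "c * (p + q) = p * q - b\<^sup>2 / 4"
    using assms by (simp add: c_def field_simps)
  have "c * (p + q) < p * (p + q)"
    unfolding c using assms by (simp add: algebra_simps add_pos_nonneg)
  then have "c < p" using assms by simp
  have disc: "b\<^sup>2 \<le> 4 * (p - c) * (q - c)"
  proof -
    have "4 * (p - c) * (q - c) = 4 * p * q - 4 * (c * (p + q)) + 4 * c\<^sup>2"
      by (simp add: algebra_simps power2_eq_square)
    then show ?thesis by (simp add: c)
  qed
  have "c * (x\<^sup>2 + y\<^sup>2) \<le> p * x\<^sup>2 + q * y\<^sup>2 + b * x * y" for x y
  proof -
    \<comment> \<open>Completing the square in x for the form with c subtracted, scaled by 4 (p -
      c); \<open>disc\<close> makes the remainder nonnegative.\<close>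
    have "0 \<le> (2 * (p - c) * x + b * y)\<^sup>2 + (4 * (p - c) * (q - c) - b\<^sup>2) * y\<^sup>2"
      using disc by simp
    also have "\<dots> = 4 * (p - c) * (p * x\<^sup>2 + q * y\<^sup>2 + b * x * y - c * (x\<^sup>2 + y\<^sup>2))"
      by (simp add: algebra_simps power2_eq_square)
    finally show ?thesis
      using \<open>c < p\<close> by (simp add: zero_le_mult_iff)
  qed
  with \<open>0 < c\<close> that show ?thesis by blast
qed

lemma inner_matrix_vector: "(A *v x) \<bullet> y = x \<bullet> (transpose A *v y)"
  for A :: "real^'n^'m"
  by (metis dot_lmul_matrix inner_commute vector_transpose_matrix)

text \<open>Positive definiteness makes the kernel trivial, and symmetry passes to the inverse. The
  last claim is what lets the adaptive law cancel the disturbance terms.\<close>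

lemma inertia_matrix_inverse:
  assumes "inertia_matrix \<I>"
  shows "\<I> ** matrix_inv \<I> = mat 1" "matrix_inv \<I> ** \<I> = mat 1"
    and "(matrix_inv \<I> *v x) \<bullet> y = x \<bullet> (matrix_inv \<I> *v y)"
proof -
  have "x = 0" if "\<I> *v x = 0" for x
    using assms that unfolding inertia_matrix_def by (metis inner_zero_right less_irrefl)
  then have "invertible \<I>"
    by (metis invertible_left_inverse matrix_left_invertible_ker)
  then show inv: "\<I> ** matrix_inv \<I> = mat 1" "matrix_inv \<I> ** \<I> = mat 1"
    unfolding invertible_def matrix_inv_def by (metis (mono_tags, lifting) someI_ex)+
  have "(matrix_inv \<I> *v x) \<bullet> y = (matrix_inv \<I> *v x) \<bullet> (\<I> *v (matrix_inv \<I> *v y))"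
    by (simp add: matrix_vector_mul_assoc inv)
  also have "\<dots> = (\<I> *v (matrix_inv \<I> *v x)) \<bullet> (matrix_inv \<I> *v y)"
    using assms by (simp add: inner_matrix_vector inertia_matrix_def)
  also have "\<dots> = x \<bullet> (matrix_inv \<I> *v y)"
    by (simp add: matrix_vector_mul_assoc inv)
  finally show "(matrix_inv \<I> *v x) \<bullet> y = x \<bullet> (matrix_inv \<I> *v y)" .
qed

section \<open>Error dynamics and the Lyapunov function\<close>

text \<open>\<open>smooth_curve\<close> only provides some tower D of derivatives. Uniqueness of
  derivatives within the half-line identifies \<open>dot f\<close> with D 1, which is continuous
  because it is differentiable.\<close>

lemma smooth_curve_dot:
  assumes "smooth_curve f"
  shows "\<And>t. 0 \<le> t \<Longrightarrow> (f has_vector_derivative dot f t) (at t within {0..})"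
    and "continuous_on {0..} (dot f)"
proof -
  obtain D where D0: "\<And>t. 0 \<le> t \<Longrightarrow> D 0 t = f t"
    and D: "\<And>n t. 0 \<le> t \<Longrightarrow> (D n has_vector_derivative D (Suc n) t) (at t within {0..})"
    using assms unfolding smooth_curve_def by blast
  have f: "(f has_vector_derivative D 1 t) (at t within {0..})" if "0 \<le> t" for t
    using has_vector_derivative_transform[OF _ _ D[of t 0], of f] D0 that by auto
  have eq: "dot f t = D 1 t" if "0 \<le> t" for t
  proof -
    have "t islimpt {t..t+1}" by (simp add: islimpt_Icc)
    then have "t islimpt {0..}"
      by (rule islimpt_subset) (use that in auto)
    then show ?thesis
      unfolding dot_def by (intro vector_derivative_within f that) (simp add: trivial_limit_within)
  qed
  have "continuous_on {0..} (D 1)"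
    using D[of _ 1] by (auto simp: continuous_on_eq_continuous_within intro!: has_vector_derivative_continuous)
  then show "continuous_on {0..} (dot f)"
    by (rule continuous_on_eq) (simp add: eq)
  show "(f has_vector_derivative dot f t) (at t within {0..})" if "0 \<le> t" for t
    using f[OF that] eq[OF that] by simp
qed

lemma tracking_loop_subset:
  assumes "tracking_loop \<I> \<Delta> kR k\<Omega> k\<Delta> \<mu> Rd \<Omega>d J R \<Omega> \<Delta>b" "J' \<subseteq> J"
  shows "tracking_loop \<I> \<Delta> kR k\<Omega> k\<Delta> \<mu> Rd \<Omega>d J' R \<Omega> \<Delta>b"
  using assms unfolding tracking_loop_def
  by (blast intro: has_vector_derivative_within_subset)

lemma norm_tracking_errors:
  "(norm (tracking_errors \<Delta> Rd \<Omega>d t (R, \<Omega>, \<Delta>b)))\<^sup>2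
    = (norm (R - Rd t))\<^sup>2 + (norm (\<Omega> - \<Omega>d t))\<^sup>2 + (norm (\<Delta> - \<Delta>b))\<^sup>2"
  by (simp add: tracking_errors_def norm_Pair)

text \<open>Without the cross term only the velocity error would be dissipated. The weight 1 / (2
  k\<Delta>) matches the adaptation gain, and the same \<mu> in the adaptive law removes the
  disturbance that the cross term brings in.\<close>

definition lyapunov :: "vec3 \<Rightarrow> real \<Rightarrow> real \<Rightarrow> real \<Rightarrow> (real \<Rightarrow> mat3) \<Rightarrow> (real \<Rightarrow> vec3) \<Rightarrow> real \<Rightarrow>
    mat3 \<Rightarrow> vec3 \<Rightarrow> vec3 \<Rightarrow> real" where
  "lyapunov \<Delta> kR k\<Delta> \<mu> Rd \<Omega>d t R \<Omega> \<Delta>b =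
     V0 kR Rd \<Omega>d R \<Omega> t + 1 / (2 * k\<Delta>) * (norm (\<Delta> - \<Delta>b))\<^sup>2 + \<mu> * (err_R (Rd t) R \<bullet> (\<Omega> - \<Omega>d t))"

text \<open>The unshifted loop by itself. \<open>\<mu>_less\<close> is the theorem's bound evaluated
  at a = 0, and it is equivalent to the third of \<open>gain_conditions\<close>.\<close>

locale attitude_tracking =
  fixes \<I> :: mat3 and \<Delta> :: vec3 and kR k\<Omega> k\<Delta> \<mu> :: real
    and Rd :: "real \<Rightarrow> mat3" and \<Omega>d :: "real \<Rightarrow> vec3"
  assumes inertia: "inertia_matrix \<I>"
    and reference: "reference_trajectory Rd \<Omega>d"
    and gains: "0 < kR" "0 < k\<Omega>" "0 < k\<Delta>" "0 < \<mu>"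
    and \<mu>_less: "\<mu> < 4 * kR * k\<Omega> / (4 * kR + k\<Omega>\<^sup>2)"
begin

abbreviation loop where "loop \<equiv> tracking_loop \<I> \<Delta> kR k\<Omega> k\<Delta> \<mu> Rd \<Omega>d"
abbreviation errors where "errors \<equiv> tracking_errors \<Delta> Rd \<Omega>d"
abbreviation V where "V \<equiv> lyapunov \<Delta> kR k\<Delta> \<mu> Rd \<Omega>d"

lemma Rd_SO3: "0 \<le> t \<Longrightarrow> Rd t \<in> SO3"
  and Rd_deriv: "0 \<le> t \<Longrightarrow> (Rd has_vector_derivative Rd t ** hat (\<Omega>d t)) (at t within {0..})"
  and \<Omega>d_deriv: "0 \<le> t \<Longrightarrow> (\<Omega>d has_vector_derivative dot \<Omega>d t) (at t within {0..})"
  using reference smooth_curve_dot(1)[of \<Omega>d] by (auto simp: reference_trajectory_def)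

text \<open>The first inequality makes \<open>V\<close> positive definite; the other two make the
  dissipation form positive definite. The third forces the second because its left side is
  positive.\<close>

lemma gain_conditions: "\<mu>\<^sup>2 < kR" "\<mu> < k\<Omega>" "\<mu> * k\<Omega>\<^sup>2 < 4 * kR * (k\<Omega> - \<mu>)"
proof -
  have *: "\<mu> * (4 * kR + k\<Omega>\<^sup>2) < 4 * kR * k\<Omega>"
    using \<mu>_less gains by (simp add: pos_less_divide_eq add_pos_pos)
  then show "\<mu> * k\<Omega>\<^sup>2 < 4 * kR * (k\<Omega> - \<mu>)"
    by (simp add: algebra_simps)
  then have "0 < 4 * kR * (k\<Omega> - \<mu>)"
    using gains by (smt (verit) mult_nonneg_nonneg zero_le_power2)
  then show "\<mu> < k\<Omega>"
    using gains by (simp add: zero_less_mult_iff)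
  \<comment> \<open>By this inequality of means, the bound in \<open>\<mu>_less\<close> is at most
    sqrt kR.\<close>
  have "4 * sqrt kR * k\<Omega> \<le> 4 * kR + k\<Omega>\<^sup>2"
    using zero_le_power2[of "2 * sqrt kR - k\<Omega>"] gains by (simp add: power2_diff power_mult_distrib)
  then have "\<mu> * (4 * sqrt kR * k\<Omega>) \<le> \<mu> * (4 * kR + k\<Omega>\<^sup>2)"
    using gains by (intro mult_left_mono) auto
  also have "\<dots> < sqrt kR * (4 * sqrt kR * k\<Omega>)"
  proof -
    have "sqrt kR * (4 * sqrt kR * k\<Omega>) = 4 * (sqrt kR * sqrt kR) * k\<Omega>"
      by (simp only: mult_ac)
    also have "\<dots> = 4 * kR * k\<Omega>"
      using gains by simp
    finally show ?thesis using * by linarith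
  qed
  finally have "\<mu> < sqrt kR"
    using gains by (simp add: mult_less_cancel_right)
  then show "\<mu>\<^sup>2 < kR"
    using gains by (metis less_imp_le real_less_rsqrt real_sqrt_less_iff real_sqrt_abs abs_of_pos)
qed

text \<open>For the attitude, Q' is Q hat(e\<Omega>) plus the commutator of Q with hat(\<Omega>d),
  which \<open>axial_commutator_hat\<close> evaluates. For the velocity, the control cancels the
  gyroscopic torque and leaves the disturbance error as forcing.\<close>

lemma error_dynamics:
  assumes "loop J R \<Omega> \<Delta>b" "J \<subseteq> {0..}" "t \<in> J"
  defines "Q \<equiv> transpose (Rd t) ** R t" and "eR \<equiv> err_R (Rd t) (R t)" and "e\<Omega> \<equiv> \<Omega> t - \<Omega>d t"
    and "e\<Delta> \<equiv> \<Delta> - \<Delta>b t"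
  shows "((\<lambda>s. err_R (Rd s) (R s)) has_vector_derivative axial (Q ** hat e\<Omega>) + cross3 eR (\<Omega>d t))
      (at t within J)" (is ?attitude)
    and "((\<lambda>s. \<Omega> s - \<Omega>d s) has_vector_derivative
      (- kR *\<^sub>R eR - k\<Omega> *\<^sub>R e\<Omega> + cross3 e\<Omega> (\<Omega>d t)) + matrix_inv \<I> *v e\<Delta>) (at t within J)" (is ?velocity)
    and "((\<lambda>s. \<Delta> - \<Delta>b s) has_vector_derivative - k\<Delta> *\<^sub>R (matrix_inv \<I> *v (e\<Omega> + \<mu> *\<^sub>R eR)))
      (at t within J)" (is ?estimate)
    and "((\<lambda>s. (norm (R s - Rd s))\<^sup>2) has_vector_derivative 4 * (eR \<bullet> e\<Omega>)) (at t within J)" (is ?distance)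
proof -
  have t: "0 \<le> t" using assms by auto
  note within = has_vector_derivative_within_subset[OF _ \<open>J \<subseteq> {0..}\<close>]
  note Rd' = within[OF Rd_deriv[OF t]] and \<Omega>d' = within[OF \<Omega>d_deriv[OF t]]
  have SO3: "R t \<in> SO3" "Rd t \<in> SO3" using assms t Rd_SO3 by (auto simp: tracking_loop_def)
  have R': "(R has_vector_derivative R t ** hat (\<Omega> t)) (at t within J)"
    using assms by (auto simp: tracking_loop_def)
  have "((\<lambda>s. transpose (Rd s) ** R s) has_vector_derivative
     transpose (Rd t) ** (R t ** hat (\<Omega> t)) + transpose (Rd t ** hat (\<Omega>d t)) ** R t) (at t within J)"
    by (intro bounded_bilinear.has_vector_derivative[OF bounded_bilinear_matrix_mult]
        bounded_linear.has_vector_derivative[OF bounded_linear_transpose] R' Rd')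
  also have "transpose (Rd t) ** (R t ** hat (\<Omega> t)) + transpose (Rd t ** hat (\<Omega>d t)) ** R t
      = Q ** hat e\<Omega> + (Q ** hat (\<Omega>d t) - hat (\<Omega>d t) ** Q)"
    by (simp add: Q_def e\<Omega>_def matrix_mult_simps matrix_mul_assoc transpose_hat
        linear_diff[OF bounded_linear.linear[OF bounded_linear_hat]])
  finally have "((\<lambda>s. axial (transpose (Rd s) ** R s)) has_vector_derivative
      axial (Q ** hat e\<Omega> + (Q ** hat (\<Omega>d t) - hat (\<Omega>d t) ** Q))) (at t within J)"
    by (rule bounded_linear.has_vector_derivative[OF bounded_linear_axial])
  then show ?attitude
    by (simp add: err_R_axial axial_commutator_hat linear_add[OF bounded_linear.linear[OF bounded_linear_axial]]
       eR_def Q_def)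
  obtain \<Omega>' where \<Omega>': "(\<Omega> has_vector_derivative \<Omega>') (at t within J)"
    and dyn: "\<I> *v \<Omega>' = cross3 (\<I> *v \<Omega> t) (\<Omega> t) + control \<I> kR k\<Omega> Rd \<Omega>d t (R t) (\<Omega> t) (\<Delta>b t) + \<Delta>"
    using assms by (auto simp: tracking_loop_def)
  define w where "w = - kR *\<^sub>R eR - k\<Omega> *\<^sub>R e\<Omega> + cross3 (\<Omega> t) (\<Omega>d t) + dot \<Omega>d t"
  have "\<I> *v \<Omega>' = \<I> *v w + e\<Delta>"
    unfolding dyn control_def w_def eR_def e\<Omega>_def e\<Delta>_def by simp
  then have "matrix_inv \<I> *v (\<I> *v \<Omega>') = matrix_inv \<I> *v (\<I> *v w) + matrix_inv \<I> *v e\<Delta>"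
    by (simp add: matrix_vector_right_distrib)
  then have "\<Omega>' = w + matrix_inv \<I> *v e\<Delta>"
    by (simp add: matrix_vector_mul_assoc inertia_matrix_inverse[OF inertia])
  moreover have "cross3 (\<Omega> t) (\<Omega>d t) = cross3 e\<Omega> (\<Omega>d t)"
    by (simp add: e\<Omega>_def Cross3.left_diff_distrib)
  ultimately have "\<Omega>' - dot \<Omega>d t = (- kR *\<^sub>R eR - k\<Omega> *\<^sub>R e\<Omega> + cross3 e\<Omega> (\<Omega>d t)) + matrix_inv \<I> *v e\<Delta>"
    by (simp add: w_def)
  with has_vector_derivative_diff[OF \<Omega>' \<Omega>d'] show ?velocity
    by simp
  show ?estimate
    using assms by (auto simp: tracking_loop_def intro!: derivative_eq_intros)
  have "((\<lambda>s. (R s - Rd s) \<bullet> (R s - Rd s)) has_vector_derivative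
      (R t - Rd t) \<bullet> (R t ** hat (\<Omega> t) - Rd t ** hat (\<Omega>d t))
      + (R t ** hat (\<Omega> t) - Rd t ** hat (\<Omega>d t)) \<bullet> (R t - Rd t)) (at t within J)"
    by (intro bounded_bilinear.has_vector_derivative[OF bounded_bilinear_inner]
        has_vector_derivative_diff R' Rd')
  moreover have "(R t - Rd t) \<bullet> (R t ** hat (\<Omega> t) - Rd t ** hat (\<Omega>d t)) = 2 * (eR \<bullet> e\<Omega>)"
  proof -
    \<comment> \<open>The squared distance of two rotations is 6 - 2 tr Q, so only the mixed
      products survive; the pure ones pair the identity with a skew matrix.\<close>
    have swap: "A \<bullet> (B ** hat v) = (transpose B ** A) \<bullet> hat v" for A B :: mat3 and v
      by (metis inner_commute inner_matrix_mult_left)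
    have same: "A \<bullet> (A ** hat v) = 0" if "A \<in> SO3" for A v
      by (simp add: swap SO3_orthogonal[OF that] inner_mat1_hat)
    have 1: "Rd t \<bullet> (R t ** hat (\<Omega> t)) = - (Q \<bullet> hat (\<Omega> t))"
      using inner_transpose_hat[of Q "\<Omega> t"] by (simp add: swap Q_def matrix_transpose_mul)
    have 2: "R t \<bullet> (Rd t ** hat (\<Omega>d t)) = Q \<bullet> hat (\<Omega>d t)"
      by (simp add: swap Q_def)
    have "(R t - Rd t) \<bullet> (R t ** hat (\<Omega> t) - Rd t ** hat (\<Omega>d t)) = Q \<bullet> hat (\<Omega> t) - Q \<bullet> hat (\<Omega>d t)"
      by (simp add: inner_diff_left inner_diff_right same SO3 1 2)
    also have "\<dots> = Q \<bullet> hat e\<Omega>"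
      by (simp add: e\<Omega>_def linear_diff[OF bounded_linear.linear[OF bounded_linear_hat]] inner_diff_right)
    finally show ?thesis
      by (simp add: eR_def err_R_axial inner_axial Q_def)
  qed
  ultimately show ?distance
    by (simp add: power2_norm_eq_inner inner_commute)
qed

lemma lyapunov_bounds:
  obtains c C where "0 < c" "0 < C"
    and "\<And>t R \<Omega> \<Delta>b. 0 \<le> t \<Longrightarrow> c * (norm (errors t (R, \<Omega>, \<Delta>b)))\<^sup>2 \<le> V t R \<Omega> \<Delta>b"
    and "\<And>t R \<Omega> \<Delta>b. 0 \<le> t \<Longrightarrow> V t R \<Omega> \<Delta>b \<le> C * (norm (errors t (R, \<Omega>, \<Delta>b)))\<^sup>2"
proof -
  \<comment> \<open>1 / sqrt 2 is the constant of \<open>norm_err_R_le\<close>; the discriminant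
    condition \<mu>^2 / 2 < kR / 2 is the first of \<open>gain_conditions\<close>.\<close>
  obtain c where c: "0 < c"
    "\<And>x y. c * (x\<^sup>2 + y\<^sup>2) \<le> kR / 4 * x\<^sup>2 + 1 / 2 * y\<^sup>2 + (- \<mu> / sqrt 2) * x * y"
    using quadratic_form_coercive[of "kR / 4" "1 / 2" "- \<mu> / sqrt 2"] gains gain_conditions
    by (auto simp: power_divide)
  have cross: "\<bar>\<mu> * (err_R (Rd t) R \<bullet> e)\<bar> \<le> \<mu> / sqrt 2 * norm (R - Rd t) * norm e" if "0 \<le> t" for t R e
  proof -
    have "(sqrt 2 * norm (err_R (Rd t) R))\<^sup>2 \<le> (norm (R - Rd t))\<^sup>2"
      using norm_err_R_le[OF Rd_SO3[OF that]] by (simp add: power_mult_distrib)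
    then have "sqrt 2 * norm (err_R (Rd t) R) \<le> norm (R - Rd t)"
      by (rule power2_le_imp_le) simp
    then have "norm (err_R (Rd t) R) \<le> norm (R - Rd t) / sqrt 2"
      by (simp add: field_simps)
    then have "norm (err_R (Rd t) R) * norm e \<le> norm (R - Rd t) / sqrt 2 * norm e"
      by (intro mult_right_mono) auto
    then have "\<bar>err_R (Rd t) R \<bullet> e\<bar> \<le> norm (R - Rd t) / sqrt 2 * norm e"
      using Cauchy_Schwarz_ineq2[of "err_R (Rd t) R" e] by linarith
    then have "\<mu> * \<bar>err_R (Rd t) R \<bullet> e\<bar> \<le> \<mu> * (norm (R - Rd t) / sqrt 2 * norm e)"
      using gains by (intro mult_left_mono) auto
    then show ?thesis
      using gains by (simp add: abs_mult mult.assoc)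
  qed
  define c' where "c' = min c (1 / (2 * k\<Delta>))"
  \<comment> \<open>The sum of all coefficients, each charged with the whole squared error; the
    surplus is \<open>rest\<close> below.\<close>
  define C where "C = kR / 4 + 1 / 2 + 1 / (2 * k\<Delta>) + \<mu>"
  show ?thesis
  proof (rule that)
    show "0 < c'" "0 < C" using c gains by (auto simp: c'_def C_def intro!: add_pos_pos)
    fix t :: real and R \<Omega> \<Delta>b assume t: "0 \<le> t"
    define x y z where "x = norm (R - Rd t)" and "y = norm (\<Omega> - \<Omega>d t)" and "z = norm (\<Delta> - \<Delta>b)"
    have e: "(norm (errors t (R, \<Omega>, \<Delta>b)))\<^sup>2 = x\<^sup>2 + y\<^sup>2 + z\<^sup>2"
      by (simp add: norm_tracking_errors x_def y_def z_def)
    define m where "m = \<mu> * (err_R (Rd t) R \<bullet> (\<Omega> - \<Omega>d t))"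
    have V: "V t R \<Omega> \<Delta>b = kR / 4 * x\<^sup>2 + 1 / 2 * y\<^sup>2 + 1 / (2 * k\<Delta>) * z\<^sup>2 + m"
      by (simp add: lyapunov_def V0_def x_def y_def z_def m_def)
    have m: "\<bar>m\<bar> \<le> \<mu> / sqrt 2 * x * y"
      unfolding m_def x_def y_def by (rule cross[OF t])
    have "c' * (x\<^sup>2 + y\<^sup>2) \<le> c * (x\<^sup>2 + y\<^sup>2)" "c' * z\<^sup>2 \<le> 1 / (2 * k\<Delta>) * z\<^sup>2"
      unfolding c'_def by (intro mult_right_mono; simp)+
    then show "c' * (norm (errors t (R, \<Omega>, \<Delta>b)))\<^sup>2 \<le> V t R \<Omega> \<Delta>b"
      unfolding e V using c(2)[of x y] m by (simp add: distrib_left abs_le_iff)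
    have "\<mu> / sqrt 2 \<le> \<mu>"
      using gains by (simp add: divide_le_eq)
    then have "\<mu> / sqrt 2 * (x * y) \<le> \<mu> * (x * y)"
      by (intro mult_right_mono) (auto simp: x_def y_def)
    moreover have "x * y \<le> x\<^sup>2 + y\<^sup>2"
    proof -
      have "0 \<le> x * y" by (simp add: x_def y_def)
      then show ?thesis
        using zero_le_power2[of "x - y"] unfolding power2_diff by linarith
    qed
    then have "\<mu> * (x * y) \<le> \<mu> * (x\<^sup>2 + y\<^sup>2)"
      using gains by (intro mult_left_mono) auto
    ultimately have "m \<le> \<mu> * (x\<^sup>2 + y\<^sup>2)"
      using m unfolding mult.assoc by linarith
    moreover define rest where "rest = kR / 4 * (y\<^sup>2 + z\<^sup>2) + 1 / 2 * (x\<^sup>2 + z\<^sup>2) + 1 / (2 * k\<Delta>) * (x\<^sup>2 + y\<^sup>2) + \<mu> * z\<^sup>2"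
    have "0 \<le> rest"
      using gains by (simp add: rest_def)
    moreover have "C * (x\<^sup>2 + y\<^sup>2 + z\<^sup>2)
        = kR / 4 * x\<^sup>2 + 1 / 2 * y\<^sup>2 + 1 / (2 * k\<Delta>) * z\<^sup>2 + \<mu> * (x\<^sup>2 + y\<^sup>2) + rest"
      by (simp add: C_def rest_def algebra_simps)
    ultimately show "V t R \<Omega> \<Delta>b \<le> C * (norm (errors t (R, \<Omega>, \<Delta>b)))\<^sup>2"
      unfolding e V by linarith
  qed
qed

lemma lyapunov_dissipation:
  obtains c where "0 < c"
    and "\<And>J R \<Omega> \<Delta>b t. loop J R \<Omega> \<Delta>b \<Longrightarrow> J \<subseteq> {0..} \<Longrightarrow> t \<in> J \<Longrightarrow>
      \<exists>V'. ((\<lambda>s. V s (R s) (\<Omega> s) (\<Delta>b s)) has_vector_derivative V') (at t within J) \<and>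
        V' \<le> - c * ((norm (\<Omega> t - \<Omega>d t))\<^sup>2 + (norm (err_R (Rd t) (R t)))\<^sup>2)"
proof -
  \<comment> \<open>The discriminant condition for the dissipation form in |e\<Omega>| and |eR|: the
    third of \<open>gain_conditions\<close> times \<mu>.\<close>
  have "(- \<mu> * k\<Omega>)\<^sup>2 < 4 * (k\<Omega> - \<mu>) * (\<mu> * kR)"
  proof -
    have "\<mu> * (\<mu> * k\<Omega>\<^sup>2) < \<mu> * (4 * kR * (k\<Omega> - \<mu>))"
      using gain_conditions(3) gains by simp
    then show ?thesis by (simp add: power2_eq_square mult_ac)
  qed
  then obtain c where c: "0 < c"
    "\<And>x y. c * (x\<^sup>2 + y\<^sup>2) \<le> (k\<Omega> - \<mu>) * x\<^sup>2 + (\<mu> * kR) * y\<^sup>2 + (- \<mu> * k\<Omega>) * x * y"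
    using quadratic_form_coercive[of "k\<Omega> - \<mu>" "\<mu> * kR" "- \<mu> * k\<Omega>"] gains gain_conditions(2) by auto
  show ?thesis
  proof (rule that[OF c(1)])
    fix J R \<Omega> \<Delta>b t assume loop: "loop J R \<Omega> \<Delta>b" and J: "J \<subseteq> {0..}" "t \<in> J"
    then have t: "0 \<le> t" by auto
    define Q eR e\<Omega> e\<Delta> where "Q = transpose (Rd t) ** R t" and "eR = err_R (Rd t) (R t)"
      and "e\<Omega> = \<Omega> t - \<Omega>d t" and "e\<Delta> = \<Delta> - \<Delta>b t"
    note dyn = error_dynamics[OF loop J, folded Q_def eR_def e\<Omega>_def e\<Delta>_def]
    define e\<Omega>' where "e\<Omega>' = - kR *\<^sub>R eR - k\<Omega> *\<^sub>R e\<Omega> + cross3 e\<Omega> (\<Omega>d t) + matrix_inv \<I> *v e\<Delta>"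
    define eR' where "eR' = axial (Q ** hat e\<Omega>) + cross3 eR (\<Omega>d t)"
    define e\<Delta>' where "e\<Delta>' = - k\<Delta> *\<^sub>R (matrix_inv \<I> *v (e\<Omega> + \<mu> *\<^sub>R eR))"
    note ip = bounded_bilinear.has_vector_derivative[OF bounded_bilinear_inner]
    have V': "((\<lambda>s. V s (R s) (\<Omega> s) (\<Delta>b s)) has_vector_derivative
      (kR / 4 * (4 * (eR \<bullet> e\<Omega>)) + 1 / 2 * (e\<Omega> \<bullet> e\<Omega>' + e\<Omega>' \<bullet> e\<Omega>)
       + 1 / (2 * k\<Delta>) * (e\<Delta> \<bullet> e\<Delta>' + e\<Delta>' \<bullet> e\<Delta>) + \<mu> * (eR \<bullet> e\<Omega>' + eR' \<bullet> e\<Omega>))) (at t within J)"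
      unfolding lyapunov_def V0_def power2_norm_eq_inner[of "_ - \<Omega>d _"] power2_norm_eq_inner[of "\<Delta> - _"]
      using ip[OF dyn(2) dyn(2)] ip[OF dyn(3) dyn(3)] ip[OF dyn(1) dyn(2)] dyn(4)
      unfolding e\<Omega>'_def[symmetric] eR'_def[symmetric] e\<Delta>'_def[symmetric]
        eR_def[symmetric] e\<Omega>_def[symmetric] e\<Delta>_def[symmetric]
      by (intro has_vector_derivative_add has_vector_derivative_mult_right)
    \<comment> \<open>This term works against the damping. Q preserves Frobenius norms, so D, half
      the inner product of \<open>Q ** hat e\<Omega>\<close> and \<open>hat e\<Omega>\<close>, is at
      most |e\<Omega>|^2 and costs \<mu> of the gain k\<Omega>.\<close>
    define D where "D = axial (Q ** hat e\<Omega>) \<bullet> e\<Omega>"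
    have "norm (Q ** hat e\<Omega>) = norm (hat e\<Omega>)"
      using loop J t Rd_SO3 by (simp add: Q_def norm_SO3_mult tracking_loop_def flip: matrix_mul_assoc)
    then have D: "D \<le> (norm e\<Omega>)\<^sup>2"
      using norm_cauchy_schwarz[of "Q ** hat e\<Omega>" "hat e\<Omega>"]
      by (simp add: D_def inner_axial norm_hat flip: power2_eq_square)
    \<comment> \<open>Both errors are rotated by the same \<open>\<Omega>d t\<close>, which leaves
      their inner product unchanged.\<close>
    have rot: "cross3 eR (\<Omega>d t) \<bullet> e\<Omega> + eR \<bullet> cross3 e\<Omega> (\<Omega>d t) = 0"
      by (simp add: cross3_def inner_vec_def sum_3 algebra_simps)
    have eq: "kR / 4 * (4 * (eR \<bullet> e\<Omega>)) + 1 / 2 * (e\<Omega> \<bullet> e\<Omega>' + e\<Omega>' \<bullet> e\<Omega>)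
        + 1 / (2 * k\<Delta>) * (e\<Delta> \<bullet> e\<Delta>' + e\<Delta>' \<bullet> e\<Delta>) + \<mu> * (eR \<bullet> e\<Omega>' + eR' \<bullet> e\<Omega>)
      = - k\<Omega> * (norm e\<Omega>)\<^sup>2 + \<mu> * D - \<mu> * kR * (norm eR)\<^sup>2 - \<mu> * k\<Omega> * (eR \<bullet> e\<Omega>)" (is "?V' = _")
    proof -
      have 1: "e\<Omega> \<bullet> e\<Omega>' = - kR * (eR \<bullet> e\<Omega>) - k\<Omega> * (norm e\<Omega>)\<^sup>2 + e\<Omega> \<bullet> (matrix_inv \<I> *v e\<Delta>)"
        by (simp add: e\<Omega>'_def inner_diff_right inner_add_right dot_cross_self power2_norm_eq_inner inner_commute)
      \<comment> \<open>Symmetry moves the inverse inertia matrix onto e\<Delta>, so that these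
        products cancel the disturbance terms in \<open>1\<close> and \<open>3\<close>.\<close>
      have "e\<Delta> \<bullet> e\<Delta>' = - k\<Delta> * (e\<Omega> \<bullet> (matrix_inv \<I> *v e\<Delta>) + \<mu> * (eR \<bullet> (matrix_inv \<I> *v e\<Delta>)))"
        by (simp add: e\<Delta>'_def inner_commute[of e\<Delta>] inertia_matrix_inverse[OF inertia] inner_add_left)
      then have 2: "1 / (2 * k\<Delta>) * (e\<Delta> \<bullet> e\<Delta>' + e\<Delta> \<bullet> e\<Delta>')
          = - (e\<Omega> \<bullet> (matrix_inv \<I> *v e\<Delta>) + \<mu> * (eR \<bullet> (matrix_inv \<I> *v e\<Delta>)))"
        using gains by simp
      have 3: "eR \<bullet> e\<Omega>' = - kR * (norm eR)\<^sup>2 - k\<Omega> * (eR \<bullet> e\<Omega>) + eR \<bullet> cross3 e\<Omega> (\<Omega>d t)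
          + eR \<bullet> (matrix_inv \<I> *v e\<Delta>)"
        by (simp add: e\<Omega>'_def inner_diff_right inner_add_right power2_norm_eq_inner)
      have 4: "eR' \<bullet> e\<Omega> = D - eR \<bullet> cross3 e\<Omega> (\<Omega>d t)"
        using rot by (simp add: eR'_def D_def inner_add_left)
      show ?thesis
        unfolding inner_commute[of e\<Omega>' e\<Omega>] inner_commute[of e\<Delta>' e\<Delta>] 1 2 3 4
        by (simp add: algebra_simps)
    qed
    have "\<mu> * D \<le> \<mu> * (norm e\<Omega>)\<^sup>2"
      using D gains by simp
    moreover have "- (eR \<bullet> e\<Omega>) \<le> norm e\<Omega> * norm eR"
      using Cauchy_Schwarz_ineq2[of eR e\<Omega>] by (simp add: mult.commute abs_le_iff)
    then have "(\<mu> * k\<Omega>) * - (eR \<bullet> e\<Omega>) \<le> (\<mu> * k\<Omega>) * (norm e\<Omega> * norm eR)"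
      using gains by (intro mult_left_mono) auto
    ultimately have "?V' \<le> - c * ((norm e\<Omega>)\<^sup>2 + (norm eR)\<^sup>2)"
      unfolding eq using c(2)[of "norm e\<Omega>" "norm eR"] by (simp add: algebra_simps)
    with V' show "\<exists>V'. ((\<lambda>s. V s (R s) (\<Omega> s) (\<Delta>b s)) has_vector_derivative V') (at t within J) \<and>
        V' \<le> - c * ((norm (\<Omega> t - \<Omega>d t))\<^sup>2 + (norm (err_R (Rd t) (R t)))\<^sup>2)"
      unfolding e\<Omega>_def eR_def by blast
  qed
qed

text \<open>\<open>V\<close> is nonincreasing and squeezed between c and C times the squared error,
  so K = sqrt (C / c). Evaluating at the end of a closed interval makes the bound apply to every
  prefix of a solution.\<close>

lemma error_bound:
  obtains K where "0 < K"
    and "\<And>T R \<Omega> \<Delta>b. 0 \<le> T \<Longrightarrow> loop {0..T} R \<Omega> \<Delta>b \<Longrightarrow>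
      norm (errors T (R T, \<Omega> T, \<Delta>b T)) \<le> K * norm (errors 0 (R 0, \<Omega> 0, \<Delta>b 0))"
proof -
  obtain c C where cC: "0 < c" "0 < C"
    and lower: "\<And>t R \<Omega> \<Delta>b. 0 \<le> t \<Longrightarrow> c * (norm (errors t (R, \<Omega>, \<Delta>b)))\<^sup>2 \<le> V t R \<Omega> \<Delta>b"
    and upper: "\<And>t R \<Omega> \<Delta>b. 0 \<le> t \<Longrightarrow> V t R \<Omega> \<Delta>b \<le> C * (norm (errors t (R, \<Omega>, \<Delta>b)))\<^sup>2"
    using lyapunov_bounds by blast
  obtain d where d: "0 < d"
    and diss: "\<And>J R \<Omega> \<Delta>b t. loop J R \<Omega> \<Delta>b \<Longrightarrow> J \<subseteq> {0..} \<Longrightarrow> t \<in> J \<Longrightarrow>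
      \<exists>V'. ((\<lambda>s. V s (R s) (\<Omega> s) (\<Delta>b s)) has_vector_derivative V') (at t within J) \<and>
        V' \<le> - d * ((norm (\<Omega> t - \<Omega>d t))\<^sup>2 + (norm (err_R (Rd t) (R t)))\<^sup>2)"
    using lyapunov_dissipation by blast
  show ?thesis
  proof (rule that)
    show "0 < sqrt (C / c)" using cC by simp
    fix T R \<Omega> \<Delta>b assume T: "(0::real) \<le> T" and loop: "loop {0..T} R \<Omega> \<Delta>b"
    define v where "v t = V t (R t) (\<Omega> t) (\<Delta>b t)" for t
    have "\<exists>v'. (v has_vector_derivative v') (at t within {0..T}) \<and> v' \<le> 0" if t: "t \<in> {0..T}" for t
    proof -
      obtain v' where v': "(v has_vector_derivative v') (at t within {0..T})"
        "v' \<le> - d * ((norm (\<Omega> t - \<Omega>d t))\<^sup>2 + (norm (err_R (Rd t) (R t)))\<^sup>2)"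
        using diss[OF loop _ t] unfolding v_def by auto
      moreover have "0 \<le> d * ((norm (\<Omega> t - \<Omega>d t))\<^sup>2 + (norm (err_R (Rd t) (R t)))\<^sup>2)"
        using d by simp
      ultimately show ?thesis by (intro exI[of _ v']) simp
    qed
    then obtain v' where v': "\<And>t. t \<in> {0..T} \<Longrightarrow> (v has_vector_derivative v' t) (at t within {0..T}) \<and> v' t \<le> 0"
      by metis
    have "\<exists>t\<in>{0..T}. v T - v 0 = (T - 0) *\<^sub>R v' t"
      by (rule mvt_very_simple[OF T]) (use v' in \<open>auto simp: has_vector_derivative_def\<close>)
    then obtain t where "t \<in> {0..T}" "v T - v 0 = T * v' t"
      by auto
    then have "v T \<le> v 0"
      using v'[of t] T mult_nonneg_nonpos[of T "v' t"] by auto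
    then have "c * (norm (errors T (R T, \<Omega> T, \<Delta>b T)))\<^sup>2 \<le> C * (norm (errors 0 (R 0, \<Omega> 0, \<Delta>b 0)))\<^sup>2"
      using lower[OF T, of "R T" "\<Omega> T" "\<Delta>b T"] upper[of 0 "R 0" "\<Omega> 0" "\<Delta>b 0"] by (simp add: v_def)
    then have "(norm (errors T (R T, \<Omega> T, \<Delta>b T)))\<^sup>2 \<le> C / c * (norm (errors 0 (R 0, \<Omega> 0, \<Delta>b 0)))\<^sup>2"
      using cC by (simp add: field_simps)
    also have "\<dots> = (sqrt (C / c) * norm (errors 0 (R 0, \<Omega> 0, \<Delta>b 0)))\<^sup>2"
      using cC by (simp add: power_mult_distrib)
    finally show "norm (errors T (R T, \<Omega> T, \<Delta>b T)) \<le> sqrt (C / c) * norm (errors 0 (R 0, \<Omega> 0, \<Delta>b 0))"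
      by (rule power2_le_imp_le) (use cC in simp)
  qed
qed

lemma error_components_le:
  "norm (R - Rd t) \<le> norm (errors t (R, \<Omega>, \<Delta>b))"
  "norm (\<Omega> - \<Omega>d t) \<le> norm (errors t (R, \<Omega>, \<Delta>b))"
  "norm (\<Delta> - \<Delta>b) \<le> norm (errors t (R, \<Omega>, \<Delta>b))"
  by (rule power2_le_imp_le; simp add: norm_tracking_errors)+

lemma \<Omega>d_bound: "\<exists>w>0. \<forall>t\<ge>0. norm (\<Omega>d t) \<le> w \<and> norm (dot \<Omega>d t) \<le> w"
proof -
  obtain w1 w2 where "\<forall>x\<in>\<Omega>d ` {0..}. norm x \<le> w1" "\<forall>x\<in>dot \<Omega>d ` {0..}. norm x \<le> w2"
    using reference unfolding reference_trajectory_def bounded_iff by meson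
  then show ?thesis
    by (intro exI[of _ "max 1 (max w1 w2)"]) (auto simp: le_max_iff_disj)
qed

text \<open>The bound 1 keeps the derivative of the dissipated quantity bounded. It also confines
  the attitude to the region where \<open>norm_le_err_R\<close> holds, away from the half turns, at
  which \<open>err_R\<close> vanishes too.\<close>

lemma errors_tendsto_zero:
  assumes loop: "loop {0..} R \<Omega> \<Delta>b"
    and small: "\<And>t. 0 \<le> t \<Longrightarrow> norm (errors t (R t, \<Omega> t, \<Delta>b t)) \<le> 1"
  shows "((\<lambda>t. errors t (R t, \<Omega> t, \<Delta>b t)) \<longlongrightarrow> 0) at_top"
proof -
  obtain w where w: "0 < w" "\<And>t. 0 \<le> t \<Longrightarrow> norm (\<Omega>d t) \<le> w"
    using \<Omega>d_bound by blast
  define Q eR e\<Omega> e\<Delta> where "Q t = transpose (Rd t) ** R t" and "eR t = err_R (Rd t) (R t)"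
    and "e\<Omega> t = \<Omega> t - \<Omega>d t" and "e\<Delta> t = \<Delta> - \<Delta>b t" for t
  have SO3: "R t \<in> SO3" "Rd t \<in> SO3" if "0 \<le> t" for t
    using loop that Rd_SO3 by (auto simp: tracking_loop_def)
  note dyn = error_dynamics[OF loop subset_refl, folded Q_def eR_def e\<Omega>_def e\<Delta>_def]
  have E_le: "norm (R t - Rd t) \<le> 1" if "0 \<le> t" for t
    using order_trans[OF error_components_le(1) small[OF that]] .
  have e\<Omega>_le: "norm (e\<Omega> t) \<le> 1" and e\<Delta>_le: "norm (e\<Delta> t) \<le> 1" if "0 \<le> t" for t
    using order_trans[OF error_components_le(2) small[OF that]]
      order_trans[OF error_components_le(3) small[OF that]] by (simp_all add: e\<Omega>_def e\<Delta>_def)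
  have eR_le: "norm (eR t) \<le> 1" if "0 \<le> t" for t
  proof -
    have "2 * (norm (eR t))\<^sup>2 \<le> (norm (R t - Rd t))\<^sup>2"
      unfolding eR_def by (rule norm_err_R_le[OF SO3(2)[OF that]])
    also have "\<dots> \<le> 1\<^sup>2"
      using E_le[OF that] by (intro power_mono) auto
    finally have "(norm (eR t))\<^sup>2 \<le> 1\<^sup>2" by simp
    then show ?thesis by (rule power2_le_imp_le) simp
  qed
  define eR' where "eR' t = axial (Q t ** hat (e\<Omega> t)) + cross3 (eR t) (\<Omega>d t)" for t
  define b where "b t = - kR *\<^sub>R eR t - k\<Omega> *\<^sub>R e\<Omega> t + cross3 (e\<Omega> t) (\<Omega>d t)" for t
  define z where "z t = matrix_inv \<I> *v e\<Delta> t" for t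
  define z' where "z' t = matrix_inv \<I> *v (- k\<Delta> *\<^sub>R (matrix_inv \<I> *v (e\<Omega> t + \<mu> *\<^sub>R eR t)))" for t
  define N where "N = norm (matrix_inv \<I>)"
  have cross_le: "norm (cross3 x (\<Omega>d t)) \<le> w" if "0 \<le> t" "norm x \<le> 1" for x t
    using norm_cross3_le[of x "\<Omega>d t"] mult_mono[OF that(2) w(2)[OF that(1)]] by simp
  have eR'_le: "norm (eR' t) \<le> 2 + w" if t: "0 \<le> t" for t
  proof -
    have "norm (axial (Q t ** hat (e\<Omega> t))) \<le> norm (hat (e\<Omega> t))"
      using norm_axial_le'[of "Q t ** hat (e\<Omega> t)"] SO3[OF t]
      by (simp add: Q_def norm_SO3_mult flip: matrix_mul_assoc)
    also have "\<dots> \<le> 2"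
      using norm_hat_le[of "e\<Omega> t"] e\<Omega>_le[OF t] by simp
    finally show ?thesis
      using norm_triangle_ineq[of "axial (Q t ** hat (e\<Omega> t))" "cross3 (eR t) (\<Omega>d t)"]
        cross_le[OF t eR_le[OF t]] by (simp add: eR'_def)
  qed
  have e\<Omega>'_le: "norm (b t + z t) \<le> kR + k\<Omega> + w + N" if t: "0 \<le> t" for t
  proof -
    have "norm (b t + z t) \<le> norm (kR *\<^sub>R eR t) + norm (k\<Omega> *\<^sub>R e\<Omega> t) + norm (cross3 (e\<Omega> t) (\<Omega>d t)) + norm (z t)"
      unfolding b_def
      using norm_triangle_ineq[of "- kR *\<^sub>R eR t - k\<Omega> *\<^sub>R e\<Omega> t + cross3 (e\<Omega> t) (\<Omega>d t)" "z t"]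
        norm_triangle_ineq[of "- kR *\<^sub>R eR t - k\<Omega> *\<^sub>R e\<Omega> t" "cross3 (e\<Omega> t) (\<Omega>d t)"]
        norm_triangle_ineq4[of "- kR *\<^sub>R eR t" "k\<Omega> *\<^sub>R e\<Omega> t"] by simp
    moreover have "norm (kR *\<^sub>R eR t) \<le> kR" "norm (k\<Omega> *\<^sub>R e\<Omega> t) \<le> k\<Omega>"
      using eR_le[OF t] e\<Omega>_le[OF t] gains by (simp_all add: mult_left_le)
    moreover have "norm (z t) \<le> N"
      using norm_matrix_vector_mult_le[of "matrix_inv \<I>" "e\<Delta> t"] e\<Delta>_le[OF t]
        mult_left_le[of "norm (e\<Delta> t)" N] by (simp add: z_def N_def)
    ultimately show ?thesis
      using cross_le[OF t e\<Omega>_le[OF t]] by linarith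
  qed
  define W where "W t = (norm (e\<Omega> t))\<^sup>2 + (norm (eR t))\<^sup>2" for t
  define W' where "W' t = 2 * (e\<Omega> t \<bullet> (b t + z t)) + 2 * (eR t \<bullet> eR' t)" for t
  note ip = bounded_bilinear.has_vector_derivative[OF bounded_bilinear_inner]
  have W: "(W has_vector_derivative W' t) (at t within {0..})" if t: "0 \<le> t" for t
  proof -
    have "((\<lambda>t. e\<Omega> t \<bullet> e\<Omega> t + eR t \<bullet> eR t) has_vector_derivative
        (e\<Omega> t \<bullet> (b t + z t) + (b t + z t) \<bullet> e\<Omega> t) + (eR t \<bullet> eR' t + eR' t \<bullet> eR t)) (at t within {0..})"
      using dyn(1,2)[of t] t unfolding eR'_def b_def z_def
      by (intro has_vector_derivative_add ip) auto
    then show ?thesis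
      unfolding W_def[abs_def] W'_def by (simp add: power2_norm_eq_inner inner_commute)
  qed
  obtain d where d: "0 < d"
    and diss: "\<And>J R \<Omega> \<Delta>b t. loop J R \<Omega> \<Delta>b \<Longrightarrow> J \<subseteq> {0..} \<Longrightarrow> t \<in> J \<Longrightarrow>
      \<exists>V'. ((\<lambda>s. V s (R s) (\<Omega> s) (\<Delta>b s)) has_vector_derivative V') (at t within J) \<and>
        V' \<le> - d * ((norm (\<Omega> t - \<Omega>d t))\<^sup>2 + (norm (err_R (Rd t) (R t)))\<^sup>2)"
    using lyapunov_dissipation by blast
  have "\<forall>t. \<exists>V'. 0 \<le> t \<longrightarrow> ((\<lambda>s. V s (R s) (\<Omega> s) (\<Delta>b s)) has_vector_derivative V') (at t within {0..}) \<and>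
        V' \<le> - d * W t"
    using diss[OF loop subset_refl] unfolding W_def eR_def e\<Omega>_def by auto
  then obtain V' where V': "\<And>t. 0 \<le> t \<Longrightarrow>
      ((\<lambda>s. V s (R s) (\<Omega> s) (\<Delta>b s)) has_vector_derivative V' t) (at t within {0..})"
    "\<And>t. 0 \<le> t \<Longrightarrow> V' t \<le> - d * W t"
    by metis
  obtain c C where "0 < c" "0 < C"
    and lower: "\<And>t R \<Omega> \<Delta>b. 0 \<le> t \<Longrightarrow> c * (norm (errors t (R, \<Omega>, \<Delta>b)))\<^sup>2 \<le> V t R \<Omega> \<Delta>b"
    and "\<And>t R \<Omega> \<Delta>b. 0 \<le> t \<Longrightarrow> V t R \<Omega> \<Delta>b \<le> C * (norm (errors t (R, \<Omega>, \<Delta>b)))\<^sup>2"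
    using lyapunov_bounds by blast
  have W_lim: "(W \<longlongrightarrow> 0) at_top"
  proof (rule dissipation_tendsto_zero[OF V'(1) W V'(2)])
    show "\<bar>W' t\<bar> \<le> 2 * (kR + k\<Omega> + w + N) + 2 * (2 + w)" if t: "0 \<le> t" for t
    proof -
      have "\<bar>e\<Omega> t \<bullet> (b t + z t)\<bar> \<le> norm (b t + z t)"
        using Cauchy_Schwarz_ineq2[of "e\<Omega> t" "b t + z t"] e\<Omega>_le[OF t]
          mult_left_le_one_le[of "norm (b t + z t)" "norm (e\<Omega> t)"] by simp
      moreover have "\<bar>eR t \<bullet> eR' t\<bar> \<le> norm (eR' t)"
        using Cauchy_Schwarz_ineq2[of "eR t" "eR' t"] eR_le[OF t]
          mult_left_le_one_le[of "norm (eR' t)" "norm (eR t)"] by simp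
      ultimately show ?thesis
        using eR'_le[OF t] e\<Omega>'_le[OF t] unfolding W'_def by (simp add: abs_le_iff)
    qed
    show "0 \<le> V t (R t) (\<Omega> t) (\<Delta>b t)" if "0 \<le> t" for t
      using lower[OF that, of "R t" "\<Omega> t" "\<Delta>b t"] \<open>0 < c\<close>
      by (smt (verit) mult_nonneg_nonneg zero_le_power2)
    show "0 < 2 * (kR + k\<Omega> + w + N) + 2 * (2 + w)"
      using gains w by (simp add: N_def add_pos_nonneg)
  qed (use d in \<open>auto simp: W_def\<close>)
  have sqrt_lim: "((\<lambda>t. sqrt (W t)) \<longlongrightarrow> 0) at_top"
    using tendsto_real_sqrt[OF W_lim] by simp
  have e\<Omega>_lim: "(e\<Omega> \<longlongrightarrow> 0) at_top"
    by (rule Lim_null_comparison[OF _ sqrt_lim]) (auto simp: W_def real_le_rsqrt intro!: always_eventually)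
  have eR_lim: "(eR \<longlongrightarrow> 0) at_top"
    by (rule Lim_null_comparison[OF _ sqrt_lim]) (auto simp: W_def real_le_rsqrt intro!: always_eventually)
  have nonneg: "\<forall>\<^sub>F t::real in at_top. 0 \<le> t"
    by (rule eventually_ge_at_top)
  have E_lim: "((\<lambda>t. R t - Rd t) \<longlongrightarrow> 0) at_top"
  proof (rule Lim_null_comparison)
    show "\<forall>\<^sub>F t in at_top. norm (R t - Rd t) \<le> 4 * norm (eR t)"
      using nonneg by eventually_elim (simp add: eR_def norm_le_err_R SO3 E_le)
    show "((\<lambda>t. 4 * norm (eR t)) \<longlongrightarrow> 0) at_top"
      using tendsto_mult_right_zero[OF tendsto_norm_zero[OF eR_lim], of 4] by simp
  qed
  have cross_lim: "((\<lambda>t. cross3 (e\<Omega> t) (\<Omega>d t)) \<longlongrightarrow> 0) at_top"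
  proof (rule Lim_null_comparison)
    show "\<forall>\<^sub>F t in at_top. norm (cross3 (e\<Omega> t) (\<Omega>d t)) \<le> norm (e\<Omega> t) * w"
      using nonneg
    proof eventually_elim
      case (elim t)
      then show ?case
        using norm_cross3_le[of "e\<Omega> t" "\<Omega>d t"] mult_left_mono[OF w(2)[of t], of "norm (e\<Omega> t)"] by simp
    qed
    show "((\<lambda>t. norm (e\<Omega> t) * w) \<longlongrightarrow> 0) at_top"
      using tendsto_mult_left_zero[OF tendsto_norm_zero[OF e\<Omega>_lim], of w] by simp
  qed
  have b_lim: "(b \<longlongrightarrow> 0) at_top"
    using tendsto_add[OF tendsto_diff[OF tendsto_scaleR[OF tendsto_const eR_lim] tendsto_scaleR[OF tendsto_const e\<Omega>_lim]]
        cross_lim, of "- kR" "k\<Omega>"]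
    by (simp add: b_def[abs_def])
  have mv: "bounded_linear ((*v) (matrix_inv \<I>))"
    by (rule matrix_vector_mul_bounded_linear)
  have inner_lim: "((\<lambda>t. e\<Omega> t + \<mu> *\<^sub>R eR t) \<longlongrightarrow> 0) at_top"
    using tendsto_add[OF e\<Omega>_lim tendsto_scaleR[OF tendsto_const eR_lim], of \<mu>] by simp
  have "((\<lambda>t. - k\<Delta> *\<^sub>R (matrix_inv \<I> *v (e\<Omega> t + \<mu> *\<^sub>R eR t))) \<longlongrightarrow> - k\<Delta> *\<^sub>R 0) at_top"
    using bounded_linear.tendsto_zero[OF mv inner_lim] by (intro tendsto_intros)
  then have z'_lim: "(z' \<longlongrightarrow> 0) at_top"
    unfolding z'_def[abs_def] using bounded_linear.tendsto_zero[OF mv] by simp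
  have "(z \<longlongrightarrow> 0) at_top"
  \<comment> \<open>Here z is the forcing of the velocity equation by e\<Delta>; the adaptive law
    makes z' a linear image of e\<Omega> + \<mu> eR, which tends to 0.\<close>
  proof (rule slow_forcing_tendsto_zero[OF _ _ e\<Omega>_lim b_lim z'_lim])
    show "(e\<Omega> has_vector_derivative b t + z t) (at t within {0..})" if "0 \<le> t" for t
      using dyn(2)[of t] that unfolding b_def z_def by (simp add: e\<Omega>_def[abs_def])
    show "(z has_vector_derivative z' t) (at t within {0..})" if "0 \<le> t" for t
      unfolding z_def[abs_def] z'_def
      using dyn(3)[of t] that by (intro bounded_linear.has_vector_derivative[OF mv]) auto
  qed
  then have "((\<lambda>t. \<I> *v z t) \<longlongrightarrow> 0) at_top"
    by (rule bounded_linear.tendsto_zero[OF matrix_vector_mul_bounded_linear])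
  then have "(e\<Delta> \<longlongrightarrow> 0) at_top"
    by (simp add: z_def matrix_vector_mul_assoc inertia_matrix_inverse[OF inertia])
  then have "((\<lambda>t. (R t - Rd t, e\<Omega> t, e\<Delta> t)) \<longlongrightarrow> (0, 0, 0)) at_top"
    by (intro tendsto_Pair E_lim e\<Omega>_lim)
  then show ?thesis
    by (simp add: tracking_errors_def e\<Omega>_def e\<Delta>_def zero_prod_def)
qed

end

section \<open>Global existence\<close>

text \<open>The radial retraction onto the ball of radius M; the maximum spares a case distinction
  and a zero denominator.\<close>

definition saturate :: "real \<Rightarrow> 'a::real_normed_vector \<Rightarrow> 'a" where
  "saturate M x = (M / max M (norm x)) *\<^sub>R x"

lemma saturate_eq: "0 < M \<Longrightarrow> norm x \<le> M \<Longrightarrow> saturate M x = x"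
  by (simp add: saturate_def max_def)

lemma norm_saturate_le:
  assumes "0 < M"
  shows "norm (saturate M x) \<le> M"
proof -
  have "M * norm x \<le> M * max M (norm x)"
    using assms by (intro mult_left_mono) auto
  then show ?thesis
    using assms by (simp add: saturate_def pos_divide_le_eq less_max_iff_disj)
qed

lemma continuous_on_saturate:
  assumes "0 < M" "continuous_on S f"
  shows "continuous_on S (\<lambda>x. saturate M (f x))"
  unfolding saturate_def using assms by (intro continuous_intros) (auto simp: max_def)

text \<open>The difference splits into the change of the vector and the change of the scaling
  factor; each contributes at most |x - y|, in any normed space.\<close>

lemma saturate_lipschitz:
  assumes "0 < M"
  shows "norm (saturate M x - saturate M y) \<le> 2 * norm (x - y)"
proof -
  define p q where "p = max M (norm x)" and "q = max M (norm y)"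
  have pq: "0 < p" "0 < q" "M \<le> p" "norm y \<le> q"
    using assms by (auto simp: p_def q_def)
  have "\<bar>q - p\<bar> \<le> \<bar>norm y - norm x\<bar>"
    by (auto simp: p_def q_def max_def)
  also have "\<dots> \<le> norm (x - y)"
    by (metis norm_triangle_ineq3 norm_minus_commute)
  finally have qp: "\<bar>q - p\<bar> \<le> norm (x - y)" .
  have "saturate M x - saturate M y = (M / p) *\<^sub>R (x - y) + (M / p - M / q) *\<^sub>R y"
    by (simp add: saturate_def p_def q_def algebra_simps)
  then have "norm (saturate M x - saturate M y) \<le> norm ((M / p) *\<^sub>R (x - y)) + norm ((M / p - M / q) *\<^sub>R y)"
    by (simp only: norm_triangle_ineq)
  moreover have "norm ((M / p) *\<^sub>R (x - y)) \<le> 1 * norm (x - y)"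
    unfolding norm_scaleR using pq assms by (intro mult_right_mono) auto
  moreover have "norm ((M / p - M / q) *\<^sub>R y) \<le> \<bar>q - p\<bar>"
  proof -
    have "M / p - M / q = (M / (p * q)) * (q - p)"
      using pq by (simp add: field_simps)
    then have "norm ((M / p - M / q) *\<^sub>R y) = (M / p) * (norm y / q) * \<bar>q - p\<bar>"
      using pq assms by (simp add: abs_mult)
    also have "\<dots> \<le> 1 * \<bar>q - p\<bar>"
      using pq assms by (intro mult_right_mono mult_le_one) auto
    finally show ?thesis by simp
  qed
  ultimately have "norm (saturate M x - saturate M y) \<le> norm (x - y) + \<bar>q - p\<bar>"
    unfolding mult_1 by (meson add_mono order_trans)
  also have "\<dots> \<le> 2 * norm (x - y)"
    using qp by simp
  finally show ?thesis .
qed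

text \<open>For \<open>S = R\<^sup>T R - I\<close> one has \<open>S' = S \<Omega> - \<Omega> S\<close> with \<open>\<Omega>\<close> skew, so \<open>|S|\<close> is constant.\<close>

lemma SO3_invariant:
  assumes R: "\<And>t. 0 \<le> t \<Longrightarrow> (R has_vector_derivative R t ** hat (v t)) (at t within {0..})"
    and "R 0 \<in> SO3" "0 \<le> T"
  shows "R T \<in> SO3"
proof -
  define S where "S t = transpose (R t) ** R t - mat 1" for t
  have S: "(S has_vector_derivative S t ** hat (v t) - hat (v t) ** S t) (at t within {0..})" if "0 \<le> t" for t
  proof -
    have "(S has_vector_derivative transpose (R t) ** (R t ** hat (v t)) + transpose (R t ** hat (v t)) ** R t - 0)
        (at t within {0..})"
      unfolding S_def[abs_def]
      by (intro has_vector_derivative_diff bounded_bilinear.has_vector_derivative[OF bounded_bilinear_matrix_mult]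
          bounded_linear.has_vector_derivative[OF bounded_linear_transpose] R[OF that] has_vector_derivative_const)
    then show ?thesis
      by (simp add: S_def matrix_mult_simps matrix_mul_assoc transpose_hat)
  qed
  have "S t \<bullet> (S t ** hat (v t) - hat (v t) ** S t) = 0" for t
  proof -
    have "(A ** hat w) \<bullet> A = 0" "(hat w ** A) \<bullet> A = 0" for A w
      using inner_matrix_mult_right[of A "hat w" A] inner_matrix_mult_left[of "hat w" A A]
      by (simp_all add: transpose_hat matrix_mult_simps inner_commute)
    then show ?thesis by (simp add: inner_diff_right inner_commute)
  qed
  then have deriv0: "((\<lambda>t. S t \<bullet> S t) has_vector_derivative 0) (at t within {0..})" if "0 \<le> t" for t
    using bounded_bilinear.has_vector_derivative[OF bounded_bilinear_inner S S, OF that that]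
    by (simp add: inner_commute)
  have norm_const: "S t \<bullet> S t = S 0 \<bullet> S 0" if "0 \<le> t" for t
    using mean_value_half_line[of "\<lambda>t. S t \<bullet> S t" "\<lambda>_. 0" 0 t] deriv0 that by auto
  have orth: "orthogonal_matrix (R t)" if "0 \<le> t" for t
    using norm_const[OF that] \<open>R 0 \<in> SO3\<close> by (simp add: S_def SO3_orthogonal orthogonal_matrix)
  have cont: "continuous_on {0..T} (\<lambda>t. det (R t))"
  proof -
    have "continuous_on {0..} R"
      by (auto simp: continuous_on_eq_continuous_within intro!: has_vector_derivative_continuous R)
    then have "continuous_on {0..T} R"
      by (rule continuous_on_subset) auto
    then show ?thesis
      unfolding det_3 by (intro continuous_intros)
  qed
  \<comment> \<open>Orthogonality leaves the values 1 and -1; by continuity a change of sign would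
    pass through 0.\<close>
  have "det (R T) = 1"
  proof (rule ccontr)
    assume "det (R T) \<noteq> 1"
    then have "det (R T) = -1"
      using det_orthogonal_matrix[OF orth[OF \<open>0 \<le> T\<close>]] by auto
    moreover have "det (R 0) = 1"
      using \<open>R 0 \<in> SO3\<close> by (simp add: SO3_def rotation_matrix_def)
    ultimately obtain s where "0 \<le> s" "det (R s) = 0"
      using IVT2'[of "\<lambda>t. det (R t)" T 0 0] cont \<open>0 \<le> T\<close> by auto
    then show False
      using det_orthogonal_matrix[OF orth[of s]] by auto
  qed
  with orth[OF \<open>0 \<le> T\<close>] show ?thesis
    by (simp add: SO3_def rotation_matrix_def)
qed

section \<open>The closed loop with saturated kinematics\<close>

context attitude_tracking
begin

text \<open>Only the product of attitude and angular velocity fails to be globally Lipschitz. With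
  \<open>axial\<close> for \<open>err_R\<close> and the gyroscopic torque cancelled, the rest is
  affine in the state with bounded coefficients. R ranges over all matrices, so that the state space
  is linear.\<close>

definition saturated_field :: "real \<Rightarrow> real \<Rightarrow> mat3 \<times> vec3 \<times> vec3 \<Rightarrow> mat3 \<times> vec3 \<times> vec3" where
  "saturated_field M t = (\<lambda>(R, \<Omega>, \<Delta>b).
     (saturate 2 R ** hat (saturate M \<Omega>),
      - kR *\<^sub>R axial (transpose (Rd t) ** R) - k\<Omega> *\<^sub>R (\<Omega> - \<Omega>d t) + cross3 \<Omega> (\<Omega>d t) + dot \<Omega>d t
        + matrix_inv \<I> *v (\<Delta> - \<Delta>b),
      k\<Delta> *\<^sub>R (matrix_inv \<I> *v ((\<Omega> - \<Omega>d t) + \<mu> *\<^sub>R axial (transpose (Rd t) ** R)))))"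

lemma saturated_field_solution:
  assumes M: "0 < M"
  shows "\<exists>x. x 0 = x0 \<and>
    (\<forall>t\<ge>0. (x has_vector_derivative saturated_field M t (x t)) (at t within {0..}))"
proof -
  obtain w where w: "0 < w" "\<And>t. 0 \<le> t \<Longrightarrow> norm (\<Omega>d t) \<le> w" "\<And>t. 0 \<le> t \<Longrightarrow> norm (dot \<Omega>d t) \<le> w"
    using \<Omega>d_bound by blast
  define N where "N = norm (matrix_inv \<I>)"
  have N: "0 \<le> N" "norm (matrix_inv \<I> *v x) \<le> N * norm x" for x
    by (simp_all add: N_def norm_matrix_vector_mult_le)
  have ax: "norm (axial (transpose (Rd t) ** R)) \<le> norm R" if "0 \<le> t" for t R
    using norm_axial_le'[of "transpose (Rd t) ** R"] by (simp add: norm_SO3_mult[OF Rd_SO3[OF that]])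
  have norm3_le: "norm (a, b, c) \<le> norm a + norm b + norm c" for a :: mat3 and b c :: vec3
    using norm_Pair_le[of a "(b, c)"] norm_Pair_le[of b c] by linarith
  \<comment> \<open>One summand per component. The product rule gives 8 as attitude bound times hat
    constant times saturation constant, and 4 * M with M in place of the attitude bound.\<close>
  define L where "L = (8 + 4 * M) + (kR + k\<Omega> + w + N) + k\<Delta> * (N * (1 + \<mu>))"
  have cont: "continuous_on ({0..} \<times> UNIV) (\<lambda>p. saturated_field M (fst p) (snd p))"
  proof -
    have c: "continuous_on ({0..} \<times> UNIV) (\<lambda>p. g (fst p))" if "continuous_on {0..} g"
      for g :: "real \<Rightarrow> 'b::topological_space"
      by (rule continuous_on_compose2[OF that]) (auto intro!: continuous_intros)
    have Rd: "continuous_on {0..} Rd" and \<Omega>d: "continuous_on {0..} \<Omega>d" 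
      by (auto simp: continuous_on_eq_continuous_within intro!: has_vector_derivative_continuous Rd_deriv \<Omega>d_deriv)
    have d\<Omega>d: "continuous_on {0..} (dot \<Omega>d)"
      using reference smooth_curve_dot(2) by (auto simp: reference_trajectory_def)
    note mult = bounded_bilinear.continuous_on[OF bounded_bilinear_matrix_mult]
      bounded_linear.continuous_on[OF bounded_linear_hat] bounded_linear.continuous_on[OF bounded_linear_axial]
      bounded_linear.continuous_on[OF bounded_linear_transpose]
      bounded_linear.continuous_on[OF matrix_vector_mul_bounded_linear]
      bounded_bilinear.continuous_on[OF bounded_bilinear_cross3]
    have field: "saturated_field M (fst p) (snd p) =
     (saturate 2 (fst (snd p)) ** hat (saturate M (fst (snd (snd p)))),
      - kR *\<^sub>R axial (transpose (Rd (fst p)) ** fst (snd p)) - k\<Omega> *\<^sub>R (fst (snd (snd p)) - \<Omega>d (fst p))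
        + cross3 (fst (snd (snd p))) (\<Omega>d (fst p)) + dot \<Omega>d (fst p) + matrix_inv \<I> *v (\<Delta> - snd (snd (snd p))),
      k\<Delta> *\<^sub>R (matrix_inv \<I> *v ((fst (snd (snd p)) - \<Omega>d (fst p)) + \<mu> *\<^sub>R axial (transpose (Rd (fst p)) ** fst (snd p)))))"
      for p
      by (simp add: saturated_field_def split_beta)
    show ?thesis
      unfolding field
      by (intro continuous_on_Pair continuous_on_add continuous_on_diff continuous_on_scaleR mult
          continuous_on_saturate c[OF Rd] c[OF \<Omega>d] c[OF d\<Omega>d] continuous_on_fst continuous_on_snd
          continuous_on_const continuous_on_id M zero_less_numeral)
  qed
  have lip: "norm (saturated_field M t x - saturated_field M t y) \<le> L * norm (x - y)" if t: "0 \<le> t" for t x y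
  proof -
    obtain R \<Omega> D R' \<Omega>' D' where x: "x = (R, \<Omega>, D)" and y: "y = (R', \<Omega>', D')"
      by (metis prod.exhaust)
    define d where "d = norm (x - y)"
    have d: "norm (R - R') \<le> d" "norm (\<Omega> - \<Omega>') \<le> d" "norm (D' - D) \<le> d"
      using norm_fst_le[of "R - R'" "(\<Omega> - \<Omega>', D - D')"] norm_snd_le[of "(\<Omega> - \<Omega>', D - D')" "R - R'"]
        norm_fst_le[of "\<Omega> - \<Omega>'" "D - D'"] norm_snd_le[of "D - D'" "\<Omega> - \<Omega>'"]
      by (auto simp: d_def x y norm_minus_commute[of D'])
    have d0: "0 \<le> d" by (simp add: d_def)
    define P where "P = axial (transpose (Rd t) ** (R - R'))"
    have P: "norm P \<le> d" using ax[OF t, of "R - R'"] d by (simp add: P_def)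
    have P_eq: "axial (transpose (Rd t) ** R) - axial (transpose (Rd t) ** R') = P"
      by (simp add: P_def matrix_mult_simps linear_diff[OF bounded_linear.linear[OF bounded_linear_axial]])
    define f1 where "f1 = saturate 2 R ** hat (saturate M \<Omega>) - saturate 2 R' ** hat (saturate M \<Omega>')"
    define f2 where "f2 = - kR *\<^sub>R P - k\<Omega> *\<^sub>R (\<Omega> - \<Omega>') + cross3 (\<Omega> - \<Omega>') (\<Omega>d t) + matrix_inv \<I> *v (D' - D)"
    define f3 where "f3 = k\<Delta> *\<^sub>R (matrix_inv \<I> *v ((\<Omega> - \<Omega>') + \<mu> *\<^sub>R P))"
    have "saturated_field M t x - saturated_field M t y = (f1, f2, f3)"
      unfolding saturated_field_def x y f1_def f2_def f3_def P_eq[symmetric]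
      by (simp add: Cross3.left_diff_distrib matrix_vector_mult_diff_distrib matrix_vector_right_distrib
          algebra_simps)
    moreover have "norm f1 \<le> (8 + 4 * M) * d"
    proof -
      have "f1 = saturate 2 R ** hat (saturate M \<Omega> - saturate M \<Omega>') + (saturate 2 R - saturate 2 R') ** hat (saturate M \<Omega>')"
        by (simp add: f1_def matrix_mult_simps linear_diff[OF bounded_linear.linear[OF bounded_linear_hat]])
      then have "norm f1 \<le> norm (saturate 2 R) * norm (hat (saturate M \<Omega> - saturate M \<Omega>'))
          + norm (saturate 2 R - saturate 2 R') * norm (hat (saturate M \<Omega>'))"
        by (metis (no_types, lifting) norm_triangle_mono norm_matrix_mult_le)
      also have "\<dots> \<le> 2 * (2 * (2 * d)) + (2 * d) * (2 * M)"
      proof (intro add_mono mult_mono)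
        show "norm (hat (saturate M \<Omega> - saturate M \<Omega>')) \<le> 2 * (2 * d)"
          using norm_hat_le[of "saturate M \<Omega> - saturate M \<Omega>'"] saturate_lipschitz[OF M, of \<Omega> \<Omega>'] d by linarith
        show "norm (saturate 2 R - saturate 2 R') \<le> 2 * d"
          using saturate_lipschitz[of 2 R R'] d by simp
        show "norm (hat (saturate M \<Omega>')) \<le> 2 * M"
          using norm_hat_le[of "saturate M \<Omega>'"] norm_saturate_le[OF M, of \<Omega>'] by linarith
      qed (use d0 norm_saturate_le[of 2 R] in auto)
      finally show ?thesis by (simp add: algebra_simps)
    qed
    moreover have "norm f2 \<le> (kR + k\<Omega> + w + N) * d"
    proof -
      have "norm f2 \<le> norm (kR *\<^sub>R P) + norm (k\<Omega> *\<^sub>R (\<Omega> - \<Omega>')) + norm (cross3 (\<Omega> - \<Omega>') (\<Omega>d t))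
          + norm (matrix_inv \<I> *v (D' - D))"
        unfolding f2_def
        by (intro norm_triangle_mono order_refl order_trans[OF norm_triangle_ineq4]) simp
      moreover have "norm (kR *\<^sub>R P) \<le> kR * d" "norm (k\<Omega> *\<^sub>R (\<Omega> - \<Omega>')) \<le> k\<Omega> * d"
        using gains P d by simp_all
      moreover have "norm (cross3 (\<Omega> - \<Omega>') (\<Omega>d t)) \<le> d * w"
        using norm_cross3_le[of "\<Omega> - \<Omega>'" "\<Omega>d t"] mult_mono[OF d(2) w(2)[OF t] d0] by simp
      moreover have "norm (matrix_inv \<I> *v (D' - D)) \<le> N * d"
        using N(2)[of "D' - D"] mult_left_mono[OF d(3) N(1)] by linarith
      ultimately show ?thesis by (simp add: algebra_simps)
    qed
    moreover have "norm f3 \<le> k\<Delta> * (N * (1 + \<mu>)) * d"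
    proof -
      have "norm ((\<Omega> - \<Omega>') + \<mu> *\<^sub>R P) \<le> d + \<mu> * d"
        using gains P d by (intro norm_triangle_mono) auto
      then have "norm (matrix_inv \<I> *v ((\<Omega> - \<Omega>') + \<mu> *\<^sub>R P)) \<le> N * (d + \<mu> * d)"
        using N(2)[of "(\<Omega> - \<Omega>') + \<mu> *\<^sub>R P"] mult_left_mono[OF _ N(1)] order_trans by blast
      then have "k\<Delta> * norm (matrix_inv \<I> *v ((\<Omega> - \<Omega>') + \<mu> *\<^sub>R P)) \<le> k\<Delta> * (N * (d + \<mu> * d))"
        using gains by (intro mult_left_mono) auto
      also have "\<dots> = k\<Delta> * (N * (1 + \<mu>)) * d"
        by (simp add: algebra_simps)
      finally show ?thesis
        using gains by (simp add: f3_def)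
    qed
    ultimately show ?thesis
      using norm3_le[of f1 f2 f3] by (simp add: L_def d_def distrib_right)
  qed
  have bdd: "norm (saturated_field M t 0) \<le> (k\<Omega> * w + w + N * norm \<Delta>) + k\<Delta> * (N * w)" if t: "0 \<le> t" for t
  proof -
    have field: "saturated_field M t 0 = (0, k\<Omega> *\<^sub>R \<Omega>d t + dot \<Omega>d t + matrix_inv \<I> *v \<Delta>,
        - k\<Delta> *\<^sub>R (matrix_inv \<I> *v \<Omega>d t))"
      by (simp add: saturated_field_def zero_prod_def saturate_def linear_0[OF bounded_linear.linear[OF bounded_linear_axial]]
        bounded_bilinear.zero_left[OF bounded_bilinear_matrix_mult] bounded_bilinear.zero_right[OF bounded_bilinear_matrix_mult]
        linear_neg[OF matrix_vector_mul_linear])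
    have "norm (k\<Omega> *\<^sub>R \<Omega>d t + dot \<Omega>d t + matrix_inv \<I> *v \<Delta>) \<le> k\<Omega> * w + w + N * norm \<Delta>"
      using gains w t N by (intro norm_triangle_mono) auto
    moreover have "norm (matrix_inv \<I> *v \<Omega>d t) \<le> N * w"
      using N(2)[of "\<Omega>d t"] mult_left_mono[OF w(2)[OF t] N(1)] by linarith
    then have "k\<Delta> * norm (matrix_inv \<I> *v \<Omega>d t) \<le> k\<Delta> * (N * w)"
      using gains by (intro mult_left_mono) auto
    moreover have n: "norm (- k\<Delta> *\<^sub>R (matrix_inv \<I> *v \<Omega>d t)) = k\<Delta> * norm (matrix_inv \<I> *v \<Omega>d t)"
      using gains by simp
    ultimately show ?thesis
      using norm3_le[of 0 "k\<Omega> *\<^sub>R \<Omega>d t + dot \<Omega>d t + matrix_inv \<I> *v \<Delta>" "- k\<Delta> *\<^sub>R (matrix_inv \<I> *v \<Omega>d t)"]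
      unfolding field n norm_zero by linarith
  qed
  have "0 < L"
    using M gains w N by (simp add: L_def add_pos_nonneg)
  with cont lip bdd show ?thesis
    by (rule lipschitz_ode_global_solution)
qed

text \<open>A saturated solution solves the closed loop until its velocity error first reaches 1, which
  by \<open>error_bound\<close> never happens if the initial error is small.\<close>

lemma global_solution:
  obtains r where "0 < r"
    and "\<And>R0 \<Omega>0 \<Delta>0. R0 \<in> SO3 \<Longrightarrow> norm (errors 0 (R0, \<Omega>0, \<Delta>0)) < r \<Longrightarrow>
      \<exists>R \<Omega> \<Delta>b. loop {0..} R \<Omega> \<Delta>b \<and> R 0 = R0 \<and> \<Omega> 0 = \<Omega>0 \<and> \<Delta>b 0 = \<Delta>0"
proof -
  obtain K where K: "0 < K" "\<And>T R \<Omega> \<Delta>b. 0 \<le> T \<Longrightarrow> loop {0..T} R \<Omega> \<Delta>b \<Longrightarrow>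
      norm (errors T (R T, \<Omega> T, \<Delta>b T)) \<le> K * norm (errors 0 (R 0, \<Omega> 0, \<Delta>b 0))"
    using error_bound by blast
  obtain w where w: "0 < w" "\<And>t. 0 \<le> t \<Longrightarrow> norm (\<Omega>d t) \<le> w"
    using \<Omega>d_bound by blast
  show ?thesis
  proof (rule that)
    \<comment> \<open>Radius 1 starts the velocity error below its threshold; 1 / K keeps it there
      by \<open>error_bound\<close>.\<close>
    show "0 < min 1 (1 / K)" using K by simp
    fix R0 \<Omega>0 \<Delta>0 assume R0: "R0 \<in> SO3" and small: "norm (errors 0 (R0, \<Omega>0, \<Delta>0)) < min 1 (1 / K)"
    \<comment> \<open>While the velocity error is at most 1, |\<Omega>| is at most w + 1, so
      saturation at this level is inactive.\<close>
    obtain x where x0: "x 0 = (R0, \<Omega>0, \<Delta>0)"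
      and x: "\<And>t. 0 \<le> t \<Longrightarrow> (x has_vector_derivative saturated_field (w + 1) t (x t)) (at t within {0..})"
      using saturated_field_solution[of "w + 1" "(R0, \<Omega>0, \<Delta>0)"] w by auto
    define R \<Omega> \<Delta>b where "R t = fst (x t)" and "\<Omega> t = fst (snd (x t))" and "\<Delta>b t = snd (snd (x t))" for t
    have x_eq: "x t = (R t, \<Omega> t, \<Delta>b t)" for t
      by (simp add: R_def \<Omega>_def \<Delta>b_def)
    have R': "(R has_vector_derivative saturate 2 (R t) ** hat (saturate (w + 1) (\<Omega> t))) (at t within {0..})"
      and \<Omega>': "(\<Omega> has_vector_derivative - kR *\<^sub>R err_R (Rd t) (R t) - k\<Omega> *\<^sub>R (\<Omega> t - \<Omega>d t)
          + cross3 (\<Omega> t) (\<Omega>d t) + dot \<Omega>d t + matrix_inv \<I> *v (\<Delta> - \<Delta>b t)) (at t within {0..})"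
      and \<Delta>b': "(\<Delta>b has_vector_derivative
          k\<Delta> *\<^sub>R (matrix_inv \<I> *v ((\<Omega> t - \<Omega>d t) + \<mu> *\<^sub>R err_R (Rd t) (R t)))) (at t within {0..})"
      if "0 \<le> t" for t
      using bounded_linear.has_vector_derivative[OF bounded_linear_fst x[OF that]]
        bounded_linear.has_vector_derivative[OF bounded_linear_fst bounded_linear.has_vector_derivative[OF bounded_linear_snd x[OF that]]]
        bounded_linear.has_vector_derivative[OF bounded_linear_snd bounded_linear.has_vector_derivative[OF bounded_linear_snd x[OF that]]]
      by (simp_all add: R_def[symmetric, abs_def] \<Omega>_def[symmetric, abs_def] \<Delta>b_def[symmetric, abs_def]
          x_eq saturated_field_def err_R_axial)
    have SO3: "R t \<in> SO3" if "0 \<le> t" for t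
    proof (rule SO3_invariant[OF _ _ that])
      \<comment> \<open>The scalar saturating R can be moved into the angular velocity, so
        \<open>SO3_invariant\<close> applies before R is known to be bounded.\<close>
      show "(R has_vector_derivative R t ** hat ((2 / max 2 (norm (R t))) *\<^sub>R saturate (w + 1) (\<Omega> t))) (at t within {0..})"
        if "0 \<le> t" for t
        using R'[OF that] by (simp add: saturate_def[of 2] matrix_mult_simps
            linear_cmul[OF bounded_linear.linear[OF bounded_linear_hat]])
      show "R 0 \<in> SO3" using R0 x0 by (simp add: R_def)
    qed
    have loop: "loop J R \<Omega> \<Delta>b" if J: "J \<subseteq> {0..}" and le: "\<And>t. t \<in> J \<Longrightarrow> norm (\<Omega> t - \<Omega>d t) \<le> 1" for J
      unfolding tracking_loop_def
    proof (intro ballI conjI)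
      fix t assume "t \<in> J"
      then have t: "0 \<le> t" using J by auto
      note within = has_vector_derivative_within_subset[OF _ J]
      show "R t \<in> SO3" using SO3[OF t] .
      have "norm (\<Omega> t) \<le> w + 1"
        using le[OF \<open>t \<in> J\<close>] w(2)[OF t] norm_triangle_ineq[of "\<Omega> t - \<Omega>d t" "\<Omega>d t"] by simp
      then show "(R has_vector_derivative R t ** hat (\<Omega> t)) (at t within J)"
        using within[OF R'[OF t]] norm_SO3[OF SO3[OF t]] w by (simp add: saturate_eq)
      show "(\<Delta>b has_vector_derivative
          k\<Delta> *\<^sub>R (matrix_inv \<I> *v ((\<Omega> t - \<Omega>d t) + \<mu> *\<^sub>R err_R (Rd t) (R t)))) (at t within J)"
        by (rule within[OF \<Delta>b'[OF t]])
      show "\<exists>\<Omega>'. (\<Omega> has_vector_derivative \<Omega>') (at t within J) \<and>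
           \<I> *v \<Omega>' = cross3 (\<I> *v \<Omega> t) (\<Omega> t)
             + control \<I> kR k\<Omega> Rd \<Omega>d t (R t) (\<Omega> t) (\<Delta>b t) + \<Delta>"
        by (rule exI, rule conjI, rule within[OF \<Omega>'[OF t]])
          (simp add: control_def matrix_vector_right_distrib matrix_vector_mult_diff_distrib
            matrix_vector_mul_assoc inertia_matrix_inverse[OF inertia])
    qed
    have init: "errors 0 (R 0, \<Omega> 0, \<Delta>b 0) = errors 0 (R0, \<Omega>0, \<Delta>0)"
      using x0 by (simp add: x_eq)
    define e where "e t = norm (\<Omega> t - \<Omega>d t)" for t
    have e0: "e 0 < 1"
      using small error_components_le(2)[of "\<Omega> 0" 0 "R 0" "\<Delta>b 0"] by (simp add: init e_def)
    have e_cont: "continuous_on {0..} e"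
    proof -
      have "continuous_on {0..} \<Omega>" "continuous_on {0..} \<Omega>d"
        by (auto simp: continuous_on_eq_continuous_within intro!: has_vector_derivative_continuous \<Omega>' \<Omega>d_deriv)
      then show ?thesis unfolding e_def[abs_def] by (intro continuous_intros)
    qed
    have bound: "e T < 1" if "0 \<le> T" for T
    proof (rule ccontr)
      assume "\<not> e T < 1"
      have cont: "continuous_on {0..s} e" for s
        by (rule continuous_on_subset[OF e_cont]) auto
      define A where "A = {0..T} \<inter> e -` {1..}"
      have "closed A"
        unfolding A_def by (rule continuous_closed_preimage[OF cont]) auto
      moreover have "bounded A"
        by (rule bounded_subset[of "{0..T}"]) (auto simp: A_def)
      ultimately have "compact A"
        by (simp add: compact_eq_bounded_closed)
      moreover have "A \<noteq> {}" using that \<open>\<not> e T < 1\<close> by (auto simp: A_def)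
      ultimately obtain s where s: "s \<in> A" "\<And>t. t \<in> A \<Longrightarrow> s \<le> t"
        using compact_attains_inf[of A] by auto
      have s0: "0 \<le> s" using s by (auto simp: A_def)
      have less: "e t < 1" if "0 \<le> t" "t < s" for t
      proof (rule ccontr)
        assume "\<not> e t < 1"
        then have "t \<in> A" using s(1) that by (auto simp: A_def)
        then show False using s(2)[of t] that by simp
      qed
      \<comment> \<open>At the first time s with error at least 1, continuity makes the error
        exactly 1. The unsaturated loop tolerates this value, so it holds on the closed interval up
        to s.\<close>
      obtain t where t: "0 \<le> t" "t \<le> s" "e t = 1"
        using IVT'[of e 0 1 s] e0 s s0 cont by (auto simp: A_def)
      then have "e s = 1" using less[of t] by force
      then have "loop {0..s} R \<Omega> \<Delta>b"
        using less by (intro loop) (auto simp: e_def less_eq_real_def)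
      then have "norm (errors s (R s, \<Omega> s, \<Delta>b s)) \<le> K * norm (errors 0 (R0, \<Omega>0, \<Delta>0))"
        using K(2)[OF s0, of R \<Omega> \<Delta>b] by (simp add: init)
      also have "\<dots> < 1"
        using small K(1) by (simp add: pos_less_divide_eq mult.commute)
      finally show False
        using \<open>e s = 1\<close> error_components_le(2)[of "\<Omega> s" s "R s" "\<Delta>b s"] by (simp add: e_def)
    qed
    have "loop {0..} R \<Omega> \<Delta>b"
      using bound by (intro loop) (auto simp: e_def less_eq_real_def)
    then show "\<exists>R \<Omega> \<Delta>b. loop {0..} R \<Omega> \<Delta>b \<and> R 0 = R0 \<and> \<Omega> 0 = \<Omega>0 \<and> \<Delta>b 0 = \<Delta>0"
      using x0 by (intro exI[of _ R] exI[of _ \<Omega>] exI[of _ \<Delta>b]) (simp add: x_eq)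
  qed
qed

end

section \<open>The switched loop near zero error\<close>

theorem mainTheorem12:
  fixes \<I> :: "real ^ 3 ^ 3" and \<Delta> :: "real ^ 3"
    and Rd :: "real \<Rightarrow> real ^ 3 ^ 3" and \<Omega>d :: "real \<Rightarrow> real ^ 3"
    and \<delta> kR k\<Omega> k\<Delta> a \<mu> \<epsilon> \<theta>b0 \<gamma> :: real
  assumes "inertia_matrix \<I>"
    and "reference_trajectory Rd \<Omega>d"
    and "0 < \<delta>" and "norm \<Delta> \<le> \<delta>"
    and "0 < kR" and "0 < k\<Omega>" and "0 < k\<Delta>" and "0 < \<theta>b0" and "0 < \<gamma>"
    and "0 < a" and "a < 1" and "0 < \<epsilon>" and "\<epsilon> < 1"
    and "0 < \<mu>" and "\<mu> < 4 * (1 - a) * kR * k\<Omega> / (4 * (1 - a) * kR + k\<Omega>\<^sup>2)"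
    and "0 < B_level kR k\<Delta> a \<mu> \<delta>"
    and "\<gamma> < 2 / \<theta>b0 * sqrt (2 * (1 - \<epsilon>) * B_level kR k\<Delta> a \<mu> \<delta>)"
  shows "asymptotically_stable_zero (SO3 \<times> UNIV \<times> UNIV)
    (closed_loop \<I> \<Delta> \<delta> kR k\<Omega> k\<Delta> a \<mu> \<epsilon> \<theta>b0 \<gamma> Rd \<Omega>d)
    (tracking_errors \<Delta> Rd \<Omega>d)"
proof -
  \<comment> \<open>The bound increases with 1 - a, so it lies below its value at a = 0.\<close>
  have "4 * (1 - a) * kR * k\<Omega> / (4 * (1 - a) * kR + k\<Omega>\<^sup>2) \<le> 4 * kR * k\<Omega> / (4 * kR + k\<Omega>\<^sup>2)"
  proof -
    have pos: "0 < 4 * (1 - a) * kR + k\<Omega>\<^sup>2" "0 < 4 * kR + k\<Omega>\<^sup>2"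
      using assms(5,6,11) by (intro add_pos_pos; simp)+
    have "(4 * (1 - a) * kR * k\<Omega>) * (4 * kR + k\<Omega>\<^sup>2) + 4 * a * kR * k\<Omega> ^ 3
        = (4 * kR * k\<Omega>) * (4 * (1 - a) * kR + k\<Omega>\<^sup>2)"
      by (simp add: algebra_simps power2_eq_square power3_eq_cube)
    moreover have "0 \<le> 4 * a * kR * k\<Omega> ^ 3"
      using assms(5,6,10) by simp
    ultimately show ?thesis
      using pos by (simp only: frac_le_eq[OF pos(1)[THEN less_imp_neq, symmetric] pos(2)[THEN less_imp_neq, symmetric]])
        (simp add: divide_le_0_iff mult_pos_pos)
  qed
  with assms interpret attitude_tracking \<I> \<Delta> kR k\<Omega> k\<Delta> \<mu> Rd \<Omega>d
    by unfold_locales auto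
  let ?sol = "closed_loop \<I> \<Delta> \<delta> kR k\<Omega> k\<Delta> a \<mu> \<epsilon> \<theta>b0 \<gamma> Rd \<Omega>d"
  let ?B = "B_level kR k\<Delta> a \<mu> \<delta>"
  \<comment> \<open>\<open>V0\<close> at time 0 is at most (kR / 4 + 1 / 2) times the squared error;
    at radius r0 this majorant equals B.\<close>
  define r0 where "r0 = sqrt (?B / (kR / 4 + 1 / 2))"
  have r0: "0 < r0"
    using assms(5,16) by (simp add: r0_def add_pos_pos)
  \<comment> \<open>The branch is selected by x 0 alone, so the equivalence holds on every
    J.\<close>
  have unshifted: "?sol J x \<longleftrightarrow> loop J (\<lambda>t. fst (x t)) (\<lambda>t. fst (snd (x t))) (\<lambda>t. snd (snd (x t)))"
    if "norm (errors 0 (x 0)) < r0" for J x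
  proof -
    define R \<Omega> \<Delta>b where "R = fst (x 0)" and "\<Omega> = fst (snd (x 0))" and "\<Delta>b = snd (snd (x 0))"
    define E where "E = (norm (errors 0 (x 0)))\<^sup>2"
    have E: "(norm (R - Rd 0))\<^sup>2 \<le> E" "(norm (\<Omega> - \<Omega>d 0))\<^sup>2 \<le> E"
      using norm_tracking_errors[of \<Delta> Rd \<Omega>d 0 R \<Omega> \<Delta>b] by (simp_all add: E_def R_def \<Omega>_def \<Delta>b_def)
    have "E \<le> r0\<^sup>2"
      unfolding E_def using that by (intro power_mono) auto
    also have "\<dots> = ?B / (kR / 4 + 1 / 2)"
      using assms(5,16) by (simp add: r0_def add_pos_pos)
    finally have "(kR / 4 + 1 / 2) * E \<le> ?B"
      using assms(5) by (simp add: pos_le_divide_eq add_pos_pos mult.commute)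
    moreover have "kR / 4 * (norm (R - Rd 0))\<^sup>2 \<le> kR / 4 * E"
      using E assms(5) by (intro mult_left_mono) auto
    ultimately have "V0 kR Rd \<Omega>d R \<Omega> 0 \<le> ?B"
      using E unfolding V0_def distrib_right by linarith
    then show ?thesis
      by (simp add: closed_loop_def R_def \<Omega>_def)
  qed
  obtain r1 where r1: "0 < r1"
    and global: "\<And>R0 \<Omega>0 \<Delta>0. R0 \<in> SO3 \<Longrightarrow> norm (errors 0 (R0, \<Omega>0, \<Delta>0)) < r1 \<Longrightarrow>
      \<exists>R \<Omega> \<Delta>b. loop {0..} R \<Omega> \<Delta>b \<and> R 0 = R0 \<and> \<Omega> 0 = \<Omega>0 \<and> \<Delta>b 0 = \<Delta>0"
    using global_solution by blast
  obtain K where K: "0 < K" and bound: "\<And>T R \<Omega> \<Delta>b. 0 \<le> T \<Longrightarrow> loop {0..T} R \<Omega> \<Delta>b \<Longrightarrow>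
      norm (errors T (R T, \<Omega> T, \<Delta>b T)) \<le> K * norm (errors 0 (R 0, \<Omega> 0, \<Delta>b 0))"
    using error_bound by blast
  have bound': "norm (errors t (x t)) \<le> K * norm (errors 0 (x 0))"
    if "?sol J x" "norm (errors 0 (x 0)) < r0" "{0..t} \<subseteq> J" "0 \<le> t" for J x t
  proof -
    have "loop J (\<lambda>t. fst (x t)) (\<lambda>t. fst (snd (x t))) (\<lambda>t. snd (snd (x t)))"
      using that unshifted by blast
    from bound[OF \<open>0 \<le> t\<close> tracking_loop_subset[OF this that(3)]] show ?thesis
      by simp
  qed
  show ?thesis
    unfolding asymptotically_stable_zero_def
  proof (intro conjI)
    show "\<exists>r>0. \<forall>x0\<in>SO3 \<times> UNIV \<times> UNIV. norm (errors 0 x0) < r \<longrightarrow> (\<exists>x. ?sol {0..} x \<and> x 0 = x0)"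
    proof (intro exI[of _ "min r0 r1"] conjI ballI impI)
      fix x0 :: "mat3 \<times> vec3 \<times> vec3"
      assume "x0 \<in> SO3 \<times> UNIV \<times> UNIV" and small: "norm (errors 0 x0) < min r0 r1"
      then obtain R0 \<Omega>0 \<Delta>0 where x0: "x0 = (R0, \<Omega>0, \<Delta>0)" "R0 \<in> SO3"
        by auto
      then obtain R \<Omega> \<Delta>b where sol: "loop {0..} R \<Omega> \<Delta>b" "R 0 = R0" "\<Omega> 0 = \<Omega>0" "\<Delta>b 0 = \<Delta>0"
        using global[of R0 \<Omega>0 \<Delta>0] small by auto
      then show "\<exists>x. ?sol {0..} x \<and> x 0 = x0"
        using small unshifted[of "\<lambda>t. (R t, \<Omega> t, \<Delta>b t)" "{0..}"] x0
        by (intro exI[of _ "\<lambda>t. (R t, \<Omega> t, \<Delta>b t)"]) simp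
    qed (use r0 r1 in simp)
    show "\<forall>\<eta>>0. \<exists>r>0. \<forall>T>0. \<forall>x. ?sol {0..<T} x \<and> norm (errors 0 (x 0)) < r \<longrightarrow>
        (\<forall>t\<in>{0..<T}. norm (errors t (x t)) < \<eta>)"
    proof (intro allI impI)
      fix \<eta> :: real assume "0 < \<eta>"
      have "norm (errors t (x t)) < \<eta>"
        if "?sol {0..<T} x" "norm (errors 0 (x 0)) < min r0 (\<eta> / K)" "t \<in> {0..<T}" for T x t
      proof -
        have "norm (errors t (x t)) \<le> K * norm (errors 0 (x 0))"
          using that by (intro bound'[of "{0..<T}"]) auto
        also have "\<dots> < \<eta>"
          using that(2) K by (simp add: pos_less_divide_eq mult.commute)
        finally show ?thesis .
      qed
      then show "\<exists>r>0. \<forall>T>0. \<forall>x. ?sol {0..<T} x \<and> norm (errors 0 (x 0)) < r \<longrightarrow>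
        (\<forall>t\<in>{0..<T}. norm (errors t (x t)) < \<eta>)"
        using r0 K \<open>0 < \<eta>\<close> by (intro exI[of _ "min r0 (\<eta> / K)"]) auto
    qed
    show "\<exists>r>0. \<forall>x. ?sol {0..} x \<and> norm (errors 0 (x 0)) < r \<longrightarrow> ((\<lambda>t. errors t (x t)) \<longlongrightarrow> 0) at_top"
    \<comment> \<open>The radius 1 / K keeps the error at most 1 for all time, as
      \<open>errors_tendsto_zero\<close> requires.\<close>
    proof (intro exI[of _ "min r0 (1 / K)"] conjI allI impI)
      fix x assume x: "?sol {0..} x \<and> norm (errors 0 (x 0)) < min r0 (1 / K)"
      then have "loop {0..} (\<lambda>t. fst (x t)) (\<lambda>t. fst (snd (x t))) (\<lambda>t. snd (snd (x t)))"
        using unshifted by auto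
      moreover have "norm (errors t (x t)) \<le> 1" if "0 \<le> t" for t
      proof -
        have "norm (errors t (x t)) \<le> K * norm (errors 0 (x 0))"
          using x that by (intro bound'[of "{0..}"]) auto
        also have "\<dots> \<le> 1"
          using x K by (simp add: pos_less_divide_eq mult.commute)
        finally show ?thesis .
      qed
      ultimately show "((\<lambda>t. errors t (x t)) \<longlongrightarrow> 0) at_top"
        using errors_tendsto_zero[of "\<lambda>t. fst (x t)" "\<lambda>t. fst (snd (x t))" "\<lambda>t. snd (snd (x t))"] by simp
    qed (use r0 K in simp)
  qed
qed

end
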